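(* If the OuMv conjecture is true, there is no algorithm solving the $\#s$-$\triangle$ problem with $O(n)$-delayed predictions with update time $U(n)$ and query time $Q(n)$ satisfying $n^2U(n)+nQ(n)=\tilde{\tilde o}(n^3)$.
   Context: The $\#s$-$\triangle$ problem: a dynamic undirected graph on $n$ vertices with fixed vertex $s$; each update flips an edge (insert if absent, delete if present); each query asks for the number of triangles containing $s$. Requests arrive online; queries are answered before the next request. A permutation $\pi$ of $[T]$ acts by $\pi(\rho)=(\rho_{\pi(1)},\ldots,\rho_{\pi(T)})$ and is $d$-close to the identity if $|\pi^{-1}(t)-t|\le d$ for all $t$; a predicted sequence $\hat\rho$ is $d$-delayed for a set $\mathcal S$ of request sequences if every $\rho\in\mathcal S$ admits such a $\pi$ with $\pi(\rho)=\hat\rho$; an algorithm with $d$-delayed predictions receives $\hat\rho$ in polynomial-time preprocessing and must be correct on every sequence for which $\hat\rho$ is $d$-delayed. OuMv conjecture: for any constant $\varepsilon>0$, no algorithm for OuMv ($n\times n$ Boolean matrix $M$ preprocessed in polynomial time, then $n$ online pairs $(\vec u_t,\vec v_t)$, report Boolean $\vec u_t^\top M\vec v_t$ before next pair) runs in total time $O(n^{3-\varepsilon})$ with error probability $\le1/3$. $f(n)=\tilde{\tilde o}(n^c)$ means $f(n)\le Cn^{c-\varepsilon}$ for constants $C,\varepsilon>0$ and all large $n$. *)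

theory Defs
  imports
    "HOL-Probability.Probability"
    "HOL-Combinatorics.Permutations"
    "HOL-Library.Landau_Symbols"
begin

text \<open>
  Model of computation: a randomized word RAM, presented as a structured programming language
  with finitely many named registers and finitely many named arrays per program, unit cost per
  executed instruction, and an instruction drawing a fair random bit. The parameter \<open>W\<close> of the
  semantics is the largest number that fits into a machine word: an instruction whose result
  exceeds \<open>W\<close> has no execution, so algorithms, which are required to terminate on every input
  and every sequence of random bits, must not overflow. Below, \<open>W\<close> is polynomial in the input
  size, i.e. words have logarithmically many bits.
\<close>

type_synonym name = string

record store =
  reg :: "name \<Rightarrow> nat"
  arr :: "name \<Rightarrow> nat \<Rightarrow> nat"
  coins :: "bool stream"

datatype binop = Add | Sub | Mul | Div | Mod | BitAnd | BitOr | BitXor | ShiftL | ShiftR | Eq | Less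

fun binop_val :: "binop \<Rightarrow> nat \<Rightarrow> nat \<Rightarrow> nat" where
  "binop_val Add a b = a + b"
| "binop_val Sub a b = a - b"
| "binop_val Mul a b = a * b"
| "binop_val Div a b = a div b"
| "binop_val Mod a b = a mod b"
| "binop_val BitAnd a b = semiring_bit_operations_class.and a b"
| "binop_val BitOr a b = semiring_bit_operations_class.or a b"
| "binop_val BitXor a b = semiring_bit_operations_class.xor a b"
| "binop_val ShiftL a b = push_bit b a"
| "binop_val ShiftR a b = drop_bit b a"
| "binop_val Eq a b = of_bool (a = b)"
| "binop_val Less a b = of_bool (a < b)"

datatype com =
    Skip
  | Const name nat
  | Bin name binop name name
  | Load name name name       \<comment> \<open>\<open>Load x a i\<close> is \<open>x := a[i]\<close>\<close>
  | Store name name name      \<comment> \<open>\<open>Store a i x\<close> is \<open>a[i] := x\<close>\<close>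
  | Toss name
  | Seq com com
  | If name com com
  | While name com

text \<open>\<open>exec W c \<sigma> t \<sigma>'\<close>: started in \<open>\<sigma>\<close>, the program \<open>c\<close> halts in \<open>\<sigma>'\<close> after exactly \<open>t\<close> steps.\<close>

inductive exec :: "nat \<Rightarrow> com \<Rightarrow> store \<Rightarrow> nat \<Rightarrow> store \<Rightarrow> bool" for W :: nat where
  Skip: "exec W Skip \<sigma> 1 \<sigma>"
| Const: "k \<le> W \<Longrightarrow> exec W (Const x k) \<sigma> 1 (\<sigma>\<lparr>reg := (reg \<sigma>)(x := k)\<rparr>)"
| Bin: "r = binop_val f (reg \<sigma> y) (reg \<sigma> z) \<Longrightarrow> r \<le> W \<Longrightarrow>
    exec W (Bin x f y z) \<sigma> 1 (\<sigma>\<lparr>reg := (reg \<sigma>)(x := r)\<rparr>)"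
| Load: "exec W (Load x a i) \<sigma> 1 (\<sigma>\<lparr>reg := (reg \<sigma>)(x := arr \<sigma> a (reg \<sigma> i))\<rparr>)"
| Store: "exec W (Store a i x) \<sigma> 1
    (\<sigma>\<lparr>arr := (arr \<sigma>)(a := (arr \<sigma> a)(reg \<sigma> i := reg \<sigma> x))\<rparr>)"
| Toss: "exec W (Toss x) \<sigma> 1
    (\<sigma>\<lparr>reg := (reg \<sigma>)(x := of_bool (shd (coins \<sigma>))), coins := stl (coins \<sigma>)\<rparr>)"
| Seq: "exec W c \<sigma> t \<sigma>' \<Longrightarrow> exec W d \<sigma>' t' \<sigma>'' \<Longrightarrow> exec W (Seq c d) \<sigma> (t + t') \<sigma>''"
| IfTrue: "reg \<sigma> x \<noteq> 0 \<Longrightarrow> exec W c \<sigma> t \<sigma>' \<Longrightarrow> exec W (If x c d) \<sigma> (1 + t) \<sigma>'"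
| IfFalse: "reg \<sigma> x = 0 \<Longrightarrow> exec W d \<sigma> t \<sigma>' \<Longrightarrow> exec W (If x c d) \<sigma> (1 + t) \<sigma>'"
| WhileFalse: "reg \<sigma> x = 0 \<Longrightarrow> exec W (While x c) \<sigma> 1 \<sigma>"
| WhileTrue: "reg \<sigma> x \<noteq> 0 \<Longrightarrow> exec W c \<sigma> t \<sigma>' \<Longrightarrow> exec W (While x c) \<sigma>' t' \<sigma>'' \<Longrightarrow>
    exec W (While x c) \<sigma> (1 + t + t') \<sigma>''"

definition fair_coins :: "bool stream measure" where
  "fair_coins = stream_space (measure_pmf (bernoulli_pmf (1/2)))"

definition zero_store :: "bool stream \<Rightarrow> store" where
  "zero_store \<omega> = \<lparr>reg = (\<lambda>_. 0), arr = (\<lambda>_ _. 0), coins = \<omega>\<rparr>"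

definition strictly_below_power :: "(nat \<Rightarrow> real) \<Rightarrow> real \<Rightarrow> bool" where
  "strictly_below_power f c \<longleftrightarrow>
     (\<exists>C>0. \<exists>\<epsilon>>0. \<forall>\<^sub>F n in sequentially. f n \<le> C * real n powr (c - \<epsilon>))"

type_synonym bool_vec = "nat \<Rightarrow> bool"
type_synonym bool_mat = "nat \<Rightarrow> nat \<Rightarrow> bool"

definition uMv :: "nat \<Rightarrow> bool_mat \<Rightarrow> bool_vec \<Rightarrow> bool_vec \<Rightarrow> bool" where
  "uMv n M u v \<longleftrightarrow> (\<exists>i<n. \<exists>j<n. u i \<and> M i j \<and> v j)"

record oumv_alg =
  oumv_prep :: com
  oumv_round :: com

definition vec_array :: "nat \<Rightarrow> bool_vec \<Rightarrow> nat \<Rightarrow> nat" where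
  "vec_array n u = (\<lambda>i. if i < n then of_bool (u i) else 0)"

definition mat_array :: "nat \<Rightarrow> bool_mat \<Rightarrow> nat \<Rightarrow> nat" where
  "mat_array n M = (\<lambda>a. if a < n * n then of_bool (M (a div n) (a mod n)) else 0)"

definition oumv_init :: "nat \<Rightarrow> bool_mat \<Rightarrow> bool stream \<Rightarrow> store" where
  "oumv_init n M \<omega> = (zero_store \<omega>)
     \<lparr>reg := (\<lambda>_. 0)(''n'' := n), arr := (\<lambda>_ _. 0)(''M'' := mat_array n M)\<rparr>"

definition oumv_input :: "nat \<Rightarrow> bool_vec \<Rightarrow> bool_vec \<Rightarrow> store \<Rightarrow> store" where
  "oumv_input n u v \<sigma> =
     \<sigma>\<lparr>arr := (arr \<sigma>)(''u'' := vec_array n u, ''v'' := vec_array n v)\<rparr>"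

text \<open>
  \<open>oumv_rounds A W n \<sigma> uvs t as\<close>: from \<open>\<sigma>\<close>, the pairs \<open>uvs\<close> are served in order, in total time \<open>t\<close>,
  with reported answers \<open>as\<close>. A pair enters the store only after the answer to the previous pair
  has been read off.
\<close>

inductive oumv_rounds ::
  "oumv_alg \<Rightarrow> nat \<Rightarrow> nat \<Rightarrow> store \<Rightarrow> (bool_vec \<times> bool_vec) list \<Rightarrow> nat \<Rightarrow> nat list \<Rightarrow> bool"
  for A :: oumv_alg and W n :: nat where
  Nil: "oumv_rounds A W n \<sigma> [] 0 []"
| Cons: "exec W (oumv_round A) (oumv_input n u v \<sigma>) t \<sigma>' \<Longrightarrow> oumv_rounds A W n \<sigma>' uvs t' as \<Longrightarrow>
    oumv_rounds A W n \<sigma> ((u, v) # uvs) (t + t') (reg \<sigma>' ''answer'' # as)"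

definition oumv_run ::
  "oumv_alg \<Rightarrow> nat \<Rightarrow> nat \<Rightarrow> bool_mat \<Rightarrow> (bool_vec \<times> bool_vec) list \<Rightarrow> bool stream \<Rightarrow>
   nat \<Rightarrow> nat \<Rightarrow> nat list \<Rightarrow> bool" where
  "oumv_run A W n M uvs \<omega> p t as \<longleftrightarrow>
     (\<exists>\<sigma>. exec W (oumv_prep A) (oumv_init n M \<omega>) p \<sigma> \<and> oumv_rounds A W n \<sigma> uvs t as)"

text \<open>
  Error probability at most \<open>1/3\<close> is expressed as success probability at least \<open>2/3\<close>, because
  \<^const>\<open>measure\<close> is \<open>0\<close> on non-measurable sets. \<open>T\<close> bounds the total time of the online rounds.
\<close>

definition solves_oumv :: "oumv_alg \<Rightarrow> (nat \<Rightarrow> real) \<Rightarrow> bool" where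
  "solves_oumv A T \<longleftrightarrow>
     (\<exists>k. \<forall>n\<ge>1. \<forall>M uvs. length uvs = n \<longrightarrow>
        (\<forall>\<omega>. \<exists>p t as. oumv_run A ((n + 2) ^ k) n M uvs \<omega> p t as \<and>
               p \<le> (n + 2) ^ k \<and> real t \<le> T n) \<and>
        measure fair_coins
          {\<omega>. \<exists>p t. oumv_run A ((n + 2) ^ k) n M uvs \<omega> p t
                   (map (\<lambda>(u, v). of_bool (uMv n M u v)) uvs)} \<ge> 2 / 3)"

definition OuMv_conjecture :: bool where
  "OuMv_conjecture \<longleftrightarrow>
     (\<forall>\<epsilon>::real. \<epsilon> > 0 \<longrightarrow>
        \<not> (\<exists>A T. solves_oumv A T \<and> T \<in> O(\<lambda>n. real n powr (3 - \<epsilon>))))"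

text \<open>
  Vertices are \<open>0, \<dots>, n - 1\<close>. The undirected edge \<open>{u, v}\<close> is presented to algorithms
  as \<open>Update u v\<close> with \<open>u < v\<close>.
\<close>

datatype request = Update nat nat | Query

type_synonym graph = "nat set set"

definition valid_request :: "nat \<Rightarrow> request \<Rightarrow> bool" where
  "valid_request n r \<longleftrightarrow> (case r of Update u v \<Rightarrow> u < v \<and> v < n | Query \<Rightarrow> True)"

definition flip_edge :: "nat set \<Rightarrow> graph \<Rightarrow> graph" where
  "flip_edge e G = (if e \<in> G then G - {e} else insert e G)"

definition triangles_at :: "nat \<Rightarrow> nat \<Rightarrow> graph \<Rightarrow> nat set set" where
  "triangles_at n s G =
     {S. S \<subseteq> {..<n} \<and> card S = 3 \<and> s \<in> S \<and> (\<forall>x\<in>S. \<forall>y\<in>S. x \<noteq> y \<longrightarrow> {x, y} \<in> G)}"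

fun correct_answers :: "nat \<Rightarrow> nat \<Rightarrow> graph \<Rightarrow> request list \<Rightarrow> nat list" where
  "correct_answers n s G [] = []"
| "correct_answers n s G (Update u v # \<rho>) = correct_answers n s (flip_edge {u, v} G) \<rho>"
| "correct_answers n s G (Query # \<rho>) = card (triangles_at n s G) # correct_answers n s G \<rho>"

text \<open>Positions are numbered from \<open>0\<close>; \<open>permute_list \<pi> \<rho>\<close> is the action \<open>\<pi>(\<rho>)\<close>.\<close>

definition close_to_id :: "nat \<Rightarrow> nat \<Rightarrow> (nat \<Rightarrow> nat) \<Rightarrow> bool" where
  "close_to_id d T \<pi> \<longleftrightarrow> \<pi> permutes {..<T} \<and> (\<forall>t<T. \<bar>int (inv \<pi> t) - int t\<bar> \<le> int d)"

definition delayed_for :: "nat \<Rightarrow> request list \<Rightarrow> request list set \<Rightarrow> bool" where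
  "delayed_for d \<rho>' S \<longleftrightarrow> (\<forall>\<rho>\<in>S. \<exists>\<pi>. close_to_id d (length \<rho>) \<pi> \<and> permute_list \<pi> \<rho> = \<rho>')"

record dyn_alg =
  dyn_prep :: com
  dyn_update :: com
  dyn_query :: com

definition request_array :: "(request \<Rightarrow> nat) \<Rightarrow> request list \<Rightarrow> nat \<Rightarrow> nat" where
  "request_array f \<rho> = (\<lambda>i. if i < length \<rho> then f (\<rho> ! i) else 0)"

text \<open>
  The predicted sequence is laid out in three arrays; \<open>''kind''\<close> is \<open>1\<close> for updates and \<open>0\<close> for
  queries, \<open>''fst''\<close> and \<open>''snd''\<close> hold the endpoints of updates.
\<close>

definition dyn_init :: "nat \<Rightarrow> nat \<Rightarrow> request list \<Rightarrow> bool stream \<Rightarrow> store" where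
  "dyn_init n s \<rho>' \<omega> = (zero_store \<omega>)
     \<lparr>reg := (\<lambda>_. 0)(''n'' := n, ''s'' := s, ''T'' := length \<rho>'),
      arr := (\<lambda>_ _. 0)
        (''kind'' := request_array (\<lambda>r. case r of Update u v \<Rightarrow> 1 | Query \<Rightarrow> 0) \<rho>',
         ''fst'' := request_array (\<lambda>r. case r of Update u v \<Rightarrow> u | Query \<Rightarrow> 0) \<rho>',
         ''snd'' := request_array (\<lambda>r. case r of Update u v \<Rightarrow> v | Query \<Rightarrow> 0) \<rho>')\<rparr>"

definition update_input :: "nat \<Rightarrow> nat \<Rightarrow> store \<Rightarrow> store" where
  "update_input u v \<sigma> = \<sigma>\<lparr>reg := (reg \<sigma>)(''u'' := u, ''v'' := v)\<rparr>"

text \<open>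
  \<open>dyn_serve A W \<sigma> \<rho> ts as\<close>: from \<open>\<sigma>\<close>, the requests \<open>\<rho>\<close> are served in order; \<open>ts\<close> lists the time
  spent on each request and \<open>as\<close> the answers to the queries.
\<close>

inductive dyn_serve ::
  "dyn_alg \<Rightarrow> nat \<Rightarrow> store \<Rightarrow> request list \<Rightarrow> nat list \<Rightarrow> nat list \<Rightarrow> bool"
  for A :: dyn_alg and W :: nat where
  Nil: "dyn_serve A W \<sigma> [] [] []"
| Update: "exec W (dyn_update A) (update_input u v \<sigma>) t \<sigma>' \<Longrightarrow> dyn_serve A W \<sigma>' \<rho> ts as \<Longrightarrow>
    dyn_serve A W \<sigma> (Update u v # \<rho>) (t # ts) as"
| Query: "exec W (dyn_query A) \<sigma> t \<sigma>' \<Longrightarrow> dyn_serve A W \<sigma>' \<rho> ts as \<Longrightarrow>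
    dyn_serve A W \<sigma> (Query # \<rho>) (t # ts) (reg \<sigma>' ''answer'' # as)"

definition dyn_run ::
  "dyn_alg \<Rightarrow> nat \<Rightarrow> nat \<Rightarrow> nat \<Rightarrow> request list \<Rightarrow> request list \<Rightarrow> bool stream \<Rightarrow>
   nat \<Rightarrow> nat list \<Rightarrow> nat list \<Rightarrow> bool" where
  "dyn_run A W n s \<rho>' \<rho> \<omega> p ts as \<longleftrightarrow>
     (\<exists>\<sigma>. exec W (dyn_prep A) (dyn_init n s \<rho>' \<omega>) p \<sigma> \<and> dyn_serve A W \<sigma> \<rho> ts as)"

definition request_time :: "real \<Rightarrow> real \<Rightarrow> request \<Rightarrow> real" where
  "request_time U Q r = (case r of Update u v \<Rightarrow> U | Query \<Rightarrow> Q)"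

text \<open>
  The graph is initially empty. The input of the preprocessing has size \<open>n + length \<rho>'\<close>, up to a
  constant factor.
\<close>

definition solves_s_triangle_delayed ::
  "dyn_alg \<Rightarrow> (nat \<Rightarrow> nat) \<Rightarrow> (nat \<Rightarrow> real) \<Rightarrow> (nat \<Rightarrow> real) \<Rightarrow> bool" where
  "solves_s_triangle_delayed A d U Q \<longleftrightarrow>
     (\<exists>k. \<forall>n s \<rho>' \<rho>. s < n \<longrightarrow> (\<forall>r\<in>set \<rho>'. valid_request n r) \<longrightarrow> delayed_for (d n) \<rho>' {\<rho>} \<longrightarrow>
        (let W = (n + length \<rho>' + 2) ^ k in
          (\<forall>\<omega>. \<exists>p ts as. dyn_run A W n s \<rho>' \<rho> \<omega> p ts as \<and> p \<le> (n + length \<rho>' + 2) ^ k \<and>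
                 (\<forall>i<length \<rho>. real (ts ! i) \<le> request_time (U n) (Q n) (\<rho> ! i))) \<and>
          measure fair_coins
            {\<omega>. \<exists>p ts. dyn_run A W n s \<rho>' \<rho> \<omega> p ts (correct_answers n s {} \<rho>)} \<ge> 2 / 3))"

end

theory Submission imports Defs begin

text \<open>
  A Boolean \<open>n \<times> n\<close> matrix is stored as a bipartite graph between the rows \<open>0, \<dots>, n - 1\<close> and the
  columns \<open>n, \<dots>, 2n - 1\<close>; the source \<open>s = 3n\<close> is joined to the rows in \<open>u\<close> and the columns in \<open>v\<close>,
  so that triangles at \<open>s\<close> are the witnesses of \<open>u\<^sup>T M v\<close>. The prediction for a round is
  "flip all \<open>2n\<close> edges at \<open>s\<close>, query, flip them all again", which does not depend on \<open>(u, v)\<close>. The real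
  round flips only the selected edges before the query, the remaining ones directly after it, and then
  all of them once more: this is the same multiset of requests, moved by at most \<open>4n\<close> positions,
  and it restores the graph. A zero entry of the matrix is recorded as an edge to one of the
  dummy vertices \<open>2n, \<dots>, 3n - 1\<close>, which are never joined to \<open>s\<close>; hence the length of the
  prediction depends on \<open>n\<close> only.

  The OuMv algorithm runs the given dynamic algorithm with all its registers and arrays renamed
  apart. Its success event contains that of the dynamic algorithm, and it is measurable because
  every terminating run reads only finitely many coins.
\<close>

subsection \<open>Renaming and use of coins\<close>

text \<open>A prediction is fixed during the preprocessing, when \<open>M\<close> is known and no
  pair has arrived, so it cannot depend on what the pairs decide later. The delay provides for this:
  inside a round of \<open>4 * n + 1\<close> requests every order is allowed, and in a graph on
  \<open>3 * n + 1\<close> vertices this takes only a linear delay. Since a round flips all edges at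
  the source, selected or not, its multiset of requests is constant. The budget: \<open>n\<close>
  rounds of \<open>4 * n\<close> updates and one query cost \<open>n * (4 * n * U + Q)\<close>,
  taken at \<open>N = 3 * n + 1\<close>, which is at most \<open>N^2 * U + N * Q\<close>. The
  \<open>n * n\<close> updates that insert the matrix are charged to the OuMv preprocessing, which
  has to be polynomial; this asks for a polynomial bound on \<open>U\<close> at every size, whereas
  the hypothesis speaks of large sizes. The reduction tosses no coins of its own, so one coin stream
  drives both algorithms and success carries over run by run. An execution that fits into words up
  to \<open>W\<close> also fits into larger words, so the simulation and its own bookkeeping can
  share one larger word bound.\<close>

primrec rename :: "(name \<Rightarrow> name) \<Rightarrow> com \<Rightarrow> com" where
  "rename f Skip = Skip"
| "rename f (Const x k) = Const (f x) k"
| "rename f (Bin x g y z) = Bin (f x) g (f y) (f z)"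
| "rename f (Load x a i) = Load (f x) (f a) (f i)"
| "rename f (Store a i x) = Store (f a) (f i) (f x)"
| "rename f (Toss x) = Toss (f x)"
| "rename f (Seq c d) = Seq (rename f c) (rename f d)"
| "rename f (If x c d) = If (f x) (rename f c) (rename f d)"
| "rename f (While x c) = While (f x) (rename f c)"

text \<open>The store that the original program sees inside a larger one: names are looked up
  through \<open>f\<close>, while the coins are shared, so both programs consume the same random
  bits.\<close>

definition pull :: "(name \<Rightarrow> name) \<Rightarrow> store \<Rightarrow> store" where
  "pull f \<tau> = \<lparr>reg = reg \<tau> \<circ> f, arr = arr \<tau> \<circ> f, coins = coins \<tau>\<rparr>"

definition same_outside :: "name set \<Rightarrow> store \<Rightarrow> store \<Rightarrow> bool" where
  "same_outside X \<tau> \<tau>' \<longleftrightarrow> (\<forall>x. x \<notin> X \<longrightarrow> reg \<tau>' x = reg \<tau> x \<and> arr \<tau>' x = arr \<tau> x)"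

lemma comp_fun_upd_inj: "inj f \<Longrightarrow> g(f x := v) \<circ> f = (g \<circ> f)(x := v)"
  by (auto simp: fun_eq_iff inj_eq)

text \<open>By injectivity a write to \<open>f x\<close> is seen through \<open>pull f\<close> as a
  write to \<open>x\<close> and to nothing else. The word bound enters \<open>exec\<close> only as
  an upper bound on results, so it may grow, and the number of steps is preserved exactly.\<close>

lemma exec_rename:
  assumes "exec W c \<sigma> t \<sigma>'" "inj f" "W \<le> W'" "pull f \<tau> = \<sigma>"
  shows "\<exists>\<tau>'. exec W' (rename f c) \<tau> t \<tau>' \<and> pull f \<tau>' = \<sigma>' \<and> same_outside (range f) \<tau> \<tau>'"
  using assms
proof (induction arbitrary: \<tau> rule: exec.induct)
  case (Skip \<sigma>)
  then show ?case by (auto intro!: exI[of _ \<tau>] exec.Skip simp del: One_nat_def simp: same_outside_def)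
next
  case (Const k x \<sigma>)
  then show ?case
    by (intro exI[of _ "\<tau>\<lparr>reg := (reg \<tau>)(f x := k)\<rparr>"])
       (auto intro!: exec.Const simp del: One_nat_def simp: same_outside_def pull_def comp_fun_upd_inj)
next
  case (Bin r g \<sigma> y z x)
  then show ?case
    by (intro exI[of _ "\<tau>\<lparr>reg := (reg \<tau>)(f x := r)\<rparr>"])
       (auto intro!: exec.Bin simp del: One_nat_def simp: same_outside_def pull_def comp_fun_upd_inj)
next
  case (Load x a i \<sigma>)
  then show ?case
    by (intro exI[of _ "\<tau>\<lparr>reg := (reg \<tau>)(f x := arr \<tau> (f a) (reg \<tau> (f i)))\<rparr>"])
       (auto intro!: exec.Load simp del: One_nat_def simp: same_outside_def pull_def comp_fun_upd_inj)
next
  case (Store a i x \<sigma>)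
  then show ?case
    by (intro exI[of _ "\<tau>\<lparr>arr := (arr \<tau>)(f a := (arr \<tau> (f a))(reg \<tau> (f i) := reg \<tau> (f x)))\<rparr>"])
       (auto intro!: exec.Store simp del: One_nat_def simp: same_outside_def pull_def comp_fun_upd_inj)
next
  case (Toss x \<sigma>)
  then show ?case
    by - (intro exI conjI, unfold rename.simps, rule exec.Toss,
        auto simp: same_outside_def pull_def comp_fun_upd_inj)
next
  case (Seq c \<sigma> t \<sigma>' d t' \<sigma>'')
  from Seq.IH(1)[OF Seq.prems] obtain \<tau>1 where 1: "exec W' (rename f c) \<tau> t \<tau>1"
    "pull f \<tau>1 = \<sigma>'" "same_outside (range f) \<tau> \<tau>1" by blast
  from Seq.IH(2)[OF Seq.prems(1,2) 1(2)] obtain \<tau>2 where 2: "exec W' (rename f d) \<tau>1 t' \<tau>2"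
    "pull f \<tau>2 = \<sigma>''" "same_outside (range f) \<tau>1 \<tau>2" by blast
  from 1 2 show ?case by (auto intro!: exI[of _ \<tau>2] exec.Seq simp: same_outside_def)
next
  case (IfTrue \<sigma> x c t \<sigma>' d)
  from IfTrue.IH[OF IfTrue.prems] obtain \<tau>1 where 1: "exec W' (rename f c) \<tau> t \<tau>1"
    "pull f \<tau>1 = \<sigma>'" "same_outside (range f) \<tau> \<tau>1" by blast
  have "reg \<tau> (f x) \<noteq> 0" using IfTrue by (auto simp: pull_def)
  with 1 show ?case by (auto intro!: exI[of _ \<tau>1] exec.IfTrue simp del: One_nat_def plus_1_eq_Suc)
next
  case (IfFalse \<sigma> x d t \<sigma>' c)
  from IfFalse.IH[OF IfFalse.prems] obtain \<tau>1 where 1: "exec W' (rename f d) \<tau> t \<tau>1"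
    "pull f \<tau>1 = \<sigma>'" "same_outside (range f) \<tau> \<tau>1" by blast
  have "reg \<tau> (f x) = 0" using IfFalse by (auto simp: pull_def)
  with 1 show ?case by (auto intro!: exI[of _ \<tau>1] exec.IfFalse simp del: One_nat_def plus_1_eq_Suc)
next
  case (WhileFalse \<sigma> x c)
  then show ?case by (auto intro!: exec.WhileFalse exI[of _ \<tau>] simp del: One_nat_def simp: same_outside_def pull_def)
next
  case (WhileTrue \<sigma> x c t \<sigma>' t' \<sigma>'')
  from WhileTrue.IH(1)[OF WhileTrue.prems] obtain \<tau>1 where 1: "exec W' (rename f c) \<tau> t \<tau>1"
    "pull f \<tau>1 = \<sigma>'" "same_outside (range f) \<tau> \<tau>1" by blast
  from WhileTrue.IH(2)[OF WhileTrue.prems(1,2) 1(2)] obtain \<tau>2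
    where 2: "exec W' (rename f (While x c)) \<tau>1 t' \<tau>2"
    "pull f \<tau>2 = \<sigma>''" "same_outside (range f) \<tau>1 \<tau>2" by blast
  have "reg \<tau> (f x) \<noteq> 0" using WhileTrue by (auto simp: pull_def)
  with 1 2 have "exec W' (rename f (While x c)) \<tau> (1 + t + t') \<tau>2"
    using exec.WhileTrue by simp
  with 1 2 show ?case by (intro exI[of _ \<tau>2]) (auto simp: same_outside_def)
qed

text \<open>A halting run has finitely many steps, each reading at most one coin. The claim also
  fixes which coins remain at the end, because this is what lets two runs be composed.\<close>

lemma exec_uses_finitely_many_coins:
  assumes "exec W c \<sigma> t \<sigma>'"
  shows "\<exists>k. coins \<sigma>' = sdrop k (coins \<sigma>) \<and>
    (\<forall>\<omega>. exec W c (\<sigma>\<lparr>coins := stake k (coins \<sigma>) @- \<omega>\<rparr>) t (\<sigma>'\<lparr>coins := \<omega>\<rparr>))"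
  using assms
proof (induction rule: exec.induct)
  case (Skip \<sigma>)
  show ?case by (rule exI[of _ 0]) (auto intro!: exec.Skip simp del: One_nat_def)
next
  case (Const k x \<sigma>)
  show ?case
  proof (intro exI[of _ 0] conjI allI)
    fix \<omega> show "exec W (Const x k) (\<sigma>\<lparr>coins := stake 0 (coins \<sigma>) @- \<omega>\<rparr>) 1
      (\<sigma>\<lparr>reg := (reg \<sigma>)(x := k)\<rparr>\<lparr>coins := \<omega>\<rparr>)"
      using exec.Const[OF Const, of x "\<sigma>\<lparr>coins := \<omega>\<rparr>"] by (cases \<sigma>) simp
  qed simp
next
  case (Bin r f \<sigma> y z x)
  show ?case
  proof (intro exI[of _ 0] conjI allI)
    fix \<omega> show "exec W (Bin x f y z) (\<sigma>\<lparr>coins := stake 0 (coins \<sigma>) @- \<omega>\<rparr>) 1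
      (\<sigma>\<lparr>reg := (reg \<sigma>)(x := r)\<rparr>\<lparr>coins := \<omega>\<rparr>)"
      using exec.Bin[of r f "\<sigma>\<lparr>coins := \<omega>\<rparr>" y z W x] Bin by (cases \<sigma>) simp
  qed simp
next
  case (Load x a i \<sigma>)
  show ?case
    using exec.Load[of W x a i "\<sigma>\<lparr>coins := \<omega>\<rparr>" for \<omega>] by (intro exI[of _ 0], cases \<sigma>) simp
next
  case (Store a i x \<sigma>)
  show ?case
    using exec.Store[of W a i x "\<sigma>\<lparr>coins := \<omega>\<rparr>" for \<omega>] by (intro exI[of _ 0], cases \<sigma>) simp
next
  case (Toss x \<sigma>)
  show ?case
    using exec.Toss[of W x "\<sigma>\<lparr>coins := shd (coins \<sigma>) ## \<omega>\<rparr>" for \<omega>]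
    by (intro exI[of _ 1], cases \<sigma>) simp
next
  case (Seq c \<sigma> t \<sigma>' d t' \<sigma>'')
  then obtain k l where k: "coins \<sigma>' = sdrop k (coins \<sigma>)"
    "\<And>\<omega>. exec W c (\<sigma>\<lparr>coins := stake k (coins \<sigma>) @- \<omega>\<rparr>) t (\<sigma>'\<lparr>coins := \<omega>\<rparr>)"
    and l: "coins \<sigma>'' = sdrop l (coins \<sigma>')"
    "\<And>\<omega>. exec W d (\<sigma>'\<lparr>coins := stake l (coins \<sigma>') @- \<omega>\<rparr>) t' (\<sigma>''\<lparr>coins := \<omega>\<rparr>)" by blast
  \<comment> \<open>The tail left by the first run is instantiated with the prefix read by the
    second run, followed by arbitrary coins.\<close>
  have "exec W (Seq c d) (\<sigma>\<lparr>coins := stake (k + l) (coins \<sigma>) @- \<omega>\<rparr>) (t + t') (\<sigma>''\<lparr>coins := \<omega>\<rparr>)" for \<omega>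
    using exec.Seq[OF k(2)[of "stake l (coins \<sigma>') @- \<omega>"] l(2)[of \<omega>]]
    unfolding k(1) stake_add[symmetric] shift_append .
  moreover have "coins \<sigma>'' = sdrop (k + l) (coins \<sigma>)" by (simp add: k l sdrop_add)
  ultimately show ?case by blast
next
  case (IfTrue \<sigma> x c t \<sigma>' d)
  then obtain k where "coins \<sigma>' = sdrop k (coins \<sigma>)"
    "\<And>\<omega>. exec W c (\<sigma>\<lparr>coins := stake k (coins \<sigma>) @- \<omega>\<rparr>) t (\<sigma>'\<lparr>coins := \<omega>\<rparr>)" by blast
  with IfTrue.hyps(1) show ?case by (intro exI[of _ k] conjI allI exec.IfTrue) simp_all
next
  case (IfFalse \<sigma> x d t \<sigma>' c)
  then obtain k where "coins \<sigma>' = sdrop k (coins \<sigma>)"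
    "\<And>\<omega>. exec W d (\<sigma>\<lparr>coins := stake k (coins \<sigma>) @- \<omega>\<rparr>) t (\<sigma>'\<lparr>coins := \<omega>\<rparr>)" by blast
  with IfFalse.hyps(1) show ?case by (intro exI[of _ k] conjI allI exec.IfFalse) simp_all
next
  case (WhileFalse \<sigma> x c)
  then show ?case by (intro exI[of _ 0]) (auto intro!: exec.WhileFalse simp del: One_nat_def)
next
  case (WhileTrue \<sigma> x c t \<sigma>' t' \<sigma>'')
  then obtain k l where k: "coins \<sigma>' = sdrop k (coins \<sigma>)"
    "\<And>\<omega>. exec W c (\<sigma>\<lparr>coins := stake k (coins \<sigma>) @- \<omega>\<rparr>) t (\<sigma>'\<lparr>coins := \<omega>\<rparr>)"
    and l: "coins \<sigma>'' = sdrop l (coins \<sigma>')"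
    "\<And>\<omega>. exec W (While x c) (\<sigma>'\<lparr>coins := stake l (coins \<sigma>') @- \<omega>\<rparr>) t' (\<sigma>''\<lparr>coins := \<omega>\<rparr>)"
    by blast
  have "exec W (While x c) (\<sigma>\<lparr>coins := stake (k + l) (coins \<sigma>) @- \<omega>\<rparr>) (1 + t + t')
    (\<sigma>''\<lparr>coins := \<omega>\<rparr>)" for \<omega>
    using exec.WhileTrue[OF _ k(2)[of "stake l (coins \<sigma>') @- \<omega>"] l(2)[of \<omega>]] WhileTrue.hyps(1)
    unfolding k(1) stake_add[symmetric] shift_append by simp
  moreover have "coins \<sigma>'' = sdrop (k + l) (coins \<sigma>)" by (simp add: k l sdrop_add)
  ultimately show ?case by blast
qed

lemma oumv_rounds_use_finitely_many_coins:
  assumes "oumv_rounds A W n \<sigma> uvs t as"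
  shows "\<exists>k. \<forall>\<omega>. oumv_rounds A W n (\<sigma>\<lparr>coins := stake k (coins \<sigma>) @- \<omega>\<rparr>) uvs t as"
  using assms
proof (induction rule: oumv_rounds.induct)
  case (Nil \<sigma>)
  show ?case by (auto intro: oumv_rounds.Nil)
next
  case (Cons u v \<sigma> t \<sigma>' uvs t' as)
  have upd: "oumv_input n u v (\<sigma>\<lparr>coins := \<omega>\<rparr>) = (oumv_input n u v \<sigma>)\<lparr>coins := \<omega>\<rparr>" for \<omega>
    by (simp add: oumv_input_def)
  from exec_uses_finitely_many_coins[OF Cons.hyps(1)] obtain k where
    k: "coins \<sigma>' = sdrop k (coins \<sigma>)"
    "\<And>\<omega>. exec W (oumv_round A) (oumv_input n u v (\<sigma>\<lparr>coins := stake k (coins \<sigma>) @- \<omega>\<rparr>)) t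
       (\<sigma>'\<lparr>coins := \<omega>\<rparr>)"
    unfolding upd by (auto simp: oumv_input_def[of n u v \<sigma>])
  from Cons.IH obtain l where
    l: "\<And>\<omega>. oumv_rounds A W n (\<sigma>'\<lparr>coins := stake l (coins \<sigma>') @- \<omega>\<rparr>) uvs t' as" by blast
  have "oumv_rounds A W n (\<sigma>\<lparr>coins := stake (k + l) (coins \<sigma>) @- \<omega>\<rparr>) ((u, v) # uvs) (t + t')
    (reg \<sigma>' ''answer'' # as)" for \<omega>
    using oumv_rounds.Cons[OF k(2)[of "stake l (coins \<sigma>') @- \<omega>"] l[of \<omega>]]
    unfolding k(1) stake_add[symmetric] shift_append by simp
  then show ?case by blast
qed

lemma oumv_run_uses_finitely_many_coins:
  assumes "oumv_run A W n M uvs \<omega> p t as"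
  shows "\<exists>k. \<forall>\<omega>'. oumv_run A W n M uvs (stake k \<omega> @- \<omega>') p t as"
proof -
  from assms obtain \<sigma> where \<sigma>: "exec W (oumv_prep A) (oumv_init n M \<omega>) p \<sigma>"
    "oumv_rounds A W n \<sigma> uvs t as" by (auto simp: oumv_run_def)
  have upd: "(oumv_init n M \<omega>)\<lparr>coins := \<omega>'\<rparr> = oumv_init n M \<omega>'" for \<omega>'
    by (simp add: oumv_init_def zero_store_def)
  have co: "coins (oumv_init n M \<omega>) = \<omega>" by (simp add: oumv_init_def zero_store_def)
  from exec_uses_finitely_many_coins[OF \<sigma>(1)] obtain k where
    k: "coins \<sigma> = sdrop k \<omega>"
    "\<And>\<omega>'. exec W (oumv_prep A) (oumv_init n M (stake k \<omega> @- \<omega>')) p (\<sigma>\<lparr>coins := \<omega>'\<rparr>)"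
    by (auto simp: upd co)
  from oumv_rounds_use_finitely_many_coins[OF \<sigma>(2)] obtain l where
    l: "\<And>\<omega>. oumv_rounds A W n (\<sigma>\<lparr>coins := stake l (coins \<sigma>) @- \<omega>\<rparr>) uvs t as" by blast
  show ?thesis
  proof (intro exI[of _ "k + l"] allI)
    fix \<omega>'
    show "oumv_run A W n M uvs (stake (k + l) \<omega> @- \<omega>') p t as"
      unfolding oumv_run_def stake_add[symmetric] shift_append
      using k(2)[of "stake l (coins \<sigma>) @- \<omega>'"] l[of \<omega>'] unfolding k(1) by blast
  qed
qed

section \<open>Measurability of events decided by finitely many coins\<close>

lemma sets_fair_coins_if_determined_by_prefix:
  assumes "\<And>\<omega>. \<omega> \<in> S \<Longrightarrow> \<exists>k. \<forall>\<omega>'. stake k \<omega> @- \<omega>' \<in> S"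
  shows "S \<in> sets fair_coins"
proof -
  \<comment> \<open>\<open>L\<close> collects the finite prefixes that force membership in
    \<open>S\<close>. Then \<open>S\<close> is the union of the cylinders over \<open>L\<close>, and
    this union is countable because there are only countably many finite bit lists.\<close>
  define L where "L = {xs :: bool list. \<forall>\<omega>'. xs @- \<omega>' \<in> S}"
  have "S = (\<Union>xs\<in>L. {\<omega>. stake (length xs) \<omega> = xs})"
  proof (intro equalityI subsetI)
    fix \<omega> assume "\<omega> \<in> S"
    with assms obtain k where "\<forall>\<omega>'. stake k \<omega> @- \<omega>' \<in> S" by blast
    then show "\<omega> \<in> (\<Union>xs\<in>L. {\<omega>. stake (length xs) \<omega> = xs})"
      by (auto simp: L_def intro!: bexI[of _ "stake k \<omega>"])
  next
    fix \<omega> assume "\<omega> \<in> (\<Union>xs\<in>L. {\<omega>. stake (length xs) \<omega> = xs})"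
    then obtain xs where "xs \<in> L" "stake (length xs) \<omega> = xs" by auto
    then show "\<omega> \<in> S" using stake_sdrop[of "length xs" \<omega>] by (auto simp: L_def) metis
  qed
  moreover have "{\<omega>. stake (length xs) \<omega> = xs} \<in> sets fair_coins" for xs :: "bool list"
  proof -
    have "stake (length xs) \<in> measurable (stream_space (count_space (UNIV :: bool set))) (count_space UNIV)"
      by (rule measurable_stake)
    from measurable_sets[OF this, of "{xs}"]
    have "{\<omega>. stake (length xs) \<omega> = xs} \<in> sets (stream_space (count_space (UNIV :: bool set)))"
      by (simp add: space_stream_space vimage_def)
    also have "sets (stream_space (count_space (UNIV :: bool set))) = sets fair_coins"
      unfolding fair_coins_def by (rule sets_stream_space_cong) simp
    finally show ?thesis .
  qed
  ultimately show ?thesis by (auto intro!: sets.countable_UN')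
qed

text \<open>This is the larger of the two success events that are compared at the end; monotonicity
  of the measure requires it to be measurable.\<close>

lemma oumv_success_measurable:
  "{\<omega>. \<exists>p t. oumv_run A W n M uvs \<omega> p t as} \<in> sets fair_coins"
proof (rule sets_fair_coins_if_determined_by_prefix)
  fix \<omega> assume "\<omega> \<in> {\<omega>. \<exists>p t. oumv_run A W n M uvs \<omega> p t as}"
  then obtain p t where "oumv_run A W n M uvs \<omega> p t as" by blast
  from oumv_run_uses_finitely_many_coins[OF this]
  show "\<exists>k. \<forall>\<omega>'. stake k \<omega> @- \<omega>' \<in> {\<omega>. \<exists>p t. oumv_run A W n M uvs \<omega> p t as}" by blast
qed

lemma prob_space_fair_coins: "prob_space fair_coins"
  unfolding fair_coins_def
  by (intro prob_space.prob_space_stream_space prob_space_measure_pmf)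

subsection \<open>Request sequences of the reduction\<close>

text \<open>The two permutations act side by side, the second shifted by the length of the first
  block. The inverse of the glued map is the glued map of the inverses, so every position moves
  exactly as far as it does within its own block.\<close>

lemma close_to_id_append:
  assumes "close_to_id d (length xs) p" "close_to_id d (length ys) q"
  shows "\<exists>\<pi>. close_to_id d (length (xs @ ys)) \<pi> \<and>
    permute_list \<pi> (xs @ ys) = permute_list p xs @ permute_list q ys"
proof -
  define a b where "a = length xs" and "b = length ys"
  define glue where "glue p q t = (if t < a then p t else if t < a + b then a + q (t - a) else t)"
    for p q :: "nat \<Rightarrow> nat" and t
  have p: "p permutes {..<a}" "\<And>t. t < a \<Longrightarrow> \<bar>int (inv p t) - int t\<bar> \<le> int d"
    and q: "q permutes {..<b}" "\<And>t. t < b \<Longrightarrow> \<bar>int (inv q t) - int t\<bar> \<le> int d"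
    using assms by (auto simp: close_to_id_def a_def b_def)
  note less = permutes_in_image[OF p(1), simplified] permutes_in_image[OF q(1), simplified]
    permutes_in_image[OF permutes_inv[OF p(1)], simplified]
    permutes_in_image[OF permutes_inv[OF q(1)], simplified]
  have lr: "glue (inv p) (inv q) (glue p q t) = t" "glue p q (glue (inv p) (inv q) t) = t" for t
    using less(1)[of t] less(3)[of t] less(2)[of "t - a"] less(4)[of "t - a"]
    by (auto simp add: glue_def permutes_inverses[OF p(1)] permutes_inverses[OF q(1)] less_diff_conv2)
  have bij: "bij (glue p q)" by (rule o_bij[of "glue (inv p) (inv q)"]) (auto simp: fun_eq_iff lr)
  have perm: "glue p q permutes {..<a + b}"
    using bij by (auto simp: permutes_def bij_iff) (auto simp: glue_def)
  have inv: "inv (glue p q) = glue (inv p) (inv q)"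
    by (rule inv_unique_comp) (auto simp: fun_eq_iff lr)
  have "close_to_id d (a + b) (glue p q)"
  proof -
    have "\<bar>int (glue (inv p) (inv q) t) - int t\<bar> \<le> int d" if "t < a + b" for t
      using p(2)[of t] q(2)[of "t - a"] that by (auto simp: glue_def less_diff_conv2 algebra_simps)
    then show ?thesis using perm inv by (simp add: close_to_id_def)
  qed
  moreover have "permute_list (glue p q) (xs @ ys) = permute_list p xs @ permute_list q ys"
    using less(1,2)
    by (intro nth_equalityI) (simp_all add: permute_list_def nth_append glue_def a_def b_def less_diff_conv2)
  ultimately show ?thesis by (auto simp: a_def b_def)
qed

lemma delayed_for_append:
  assumes "delayed_for d xs' {xs}" "delayed_for d ys' {ys}"
  shows "delayed_for d (xs' @ ys') {xs @ ys}"
proof -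
  obtain p q where "close_to_id d (length xs) p" "permute_list p xs = xs'"
    "close_to_id d (length ys) q" "permute_list q ys = ys'"
    using assms by (auto simp: delayed_for_def)
  then show ?thesis using close_to_id_append[of d xs p ys q] by (auto simp: delayed_for_def)
qed

lemma delayed_for_refl: "delayed_for d xs {xs}"
  unfolding delayed_for_def close_to_id_def
  by (auto intro!: exI[of _ id] simp: permutes_id permute_list_id)

lemma delayed_for_concat:
  assumes "list_all2 (\<lambda>xs' xs. delayed_for d xs' {xs}) xss' xss"
  shows "delayed_for d (concat xss') {concat xss}"
  using assms by induction (auto intro: delayed_for_append delayed_for_refl)

text \<open>Within a list no position can move by more than its length minus one, so in a short
  block the order of the requests is free. This is what hides the vectors from the
  prediction.\<close>

lemma delayed_for_mset_eq:
  assumes "mset xs' = mset xs" "length xs \<le> d + 1"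
  shows "delayed_for d xs' {xs}"
proof -
  obtain p where p: "p permutes {..<length xs}" "permute_list p xs = xs'"
    using mset_eq_permutation[OF assms(1)] by auto
  have "\<bar>int (inv p t) - int t\<bar> \<le> int d" if "t < length xs" for t
    using permutes_in_image[OF permutes_inv[OF p(1)], of t] that assms(2) by auto
  then show ?thesis using p by (auto simp: delayed_for_def close_to_id_def)
qed

section \<open>Flipping lists of edges\<close>

definition edge :: "nat \<times> nat \<Rightarrow> nat set" where
  "edge e = {fst e, snd e}"

definition upd :: "nat \<times> nat \<Rightarrow> request" where
  "upd e = Update (fst e) (snd e)"

definition flips :: "(nat \<times> nat) list \<Rightarrow> graph \<Rightarrow> graph" where
  "flips es G = fold (\<lambda>e. flip_edge (edge e)) es G"

lemma flips_append: "flips (es @ fs) G = flips fs (flips es G)"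
  by (simp add: flips_def)

lemma correct_answers_updates:
  "correct_answers n s G (map upd es @ \<rho>) = correct_answers n s (flips es G) \<rho>"
  by (induction es arbitrary: G) (auto simp: flips_def upd_def edge_def)

text \<open>Flips of different edges do not interact and two flips of the same edge cancel, so only
  the parity of the number of occurrences matters.\<close>

lemma in_flips_iff:
  "e \<in> flips es G \<longleftrightarrow> (e \<in> G \<longleftrightarrow> even (count (mset (map edge es)) e))"
  by (induction es arbitrary: G) (auto simp: flips_def flip_edge_def)

lemma flips_distinct:
  assumes "distinct (map edge es)" "edge ` set es \<inter> G = {}"
  shows "flips es G = G \<union> edge ` set es"
proof (intro set_eqI)
  fix e
  show "e \<in> flips es G \<longleftrightarrow> e \<in> G \<union> edge ` set es"
    using assms(2) distinct_count_atmost_1[of "map edge es"] assms(1)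
    by (subst in_flips_iff) (auto simp del: mset_map)
qed

lemma flips_even:
  assumes "mset es = M + M"
  shows "flips es G = G"
  by (intro set_eqI) (simp add: in_flips_iff assms)

definition star :: "nat \<Rightarrow> (nat \<times> nat) list" where
  "star n = map (\<lambda>x. (x, 3 * n)) [0..<2 * n]"

text \<open>Row and column edges are interleaved by index, in the order in which a single loop over
  \<open>i\<close> issues them. \<open>b = True\<close> picks the edges chosen by the vectors,
  \<open>b = False\<close> the complementary ones.\<close>

definition sel_at :: "nat \<Rightarrow> bool \<Rightarrow> bool_vec \<Rightarrow> bool_vec \<Rightarrow> nat \<Rightarrow> (nat \<times> nat) list" where
  "sel_at n b u v i = (if u i = b then [(i, 3 * n)] else []) @ (if v i = b then [(n + i, 3 * n)] else [])"

definition sel :: "nat \<Rightarrow> bool \<Rightarrow> bool_vec \<Rightarrow> bool_vec \<Rightarrow> (nat \<times> nat) list" where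
  "sel n b u v = concat (map (sel_at n b u v) [0..<n])"

definition mat_edge :: "nat \<Rightarrow> bool_mat \<Rightarrow> nat \<Rightarrow> nat \<times> nat" where
  "mat_edge n M a = (a div n, if M (a div n) (a mod n) then n + a mod n else 2 * n + a mod n)"

definition mat_edges :: "nat \<Rightarrow> bool_mat \<Rightarrow> (nat \<times> nat) list" where
  "mat_edges n M = map (mat_edge n M) [0..<n * n]"

definition round_requests :: "nat \<Rightarrow> bool_vec \<Rightarrow> bool_vec \<Rightarrow> request list" where
  "round_requests n u v = map upd (sel n True u v) @ Query # map upd (sel n False u v) @ map upd (star n)"

definition predicted_round :: "nat \<Rightarrow> request list" where
  "predicted_round n = map upd (star n) @ Query # map upd (star n)"

definition requests :: "nat \<Rightarrow> bool_mat \<Rightarrow> (bool_vec \<times> bool_vec) list \<Rightarrow> request list" where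
  "requests n M uvs = map upd (mat_edges n M) @ concat (map (\<lambda>(u, v). round_requests n u v) uvs)"

definition predicted :: "nat \<Rightarrow> bool_mat \<Rightarrow> request list" where
  "predicted n M = map upd (mat_edges n M) @ concat (replicate n (predicted_round n))"

text \<open>At every index one row edge and one column edge are divided between the two selections.
  This identity yields the closeness of a round to its prediction, the number of its updates and the
  restoration of the graph.\<close>

lemma mset_sel: "mset (sel n True u v) + mset (sel n False u v) = mset (star n)"
proof -
  have "mset (sel n True u v) + mset (sel n False u v) =
    (\<Sum>i\<leftarrow>[0..<n]. {#(i, 3 * n), (n + i, 3 * n)#})"
    unfolding sel_def mset_concat map_map sum_list_addf[symmetric]
    by (intro arg_cong[of _ _ sum_list] map_cong) (auto simp: sel_at_def)
  also have "\<dots> = mset (map (\<lambda>x. (x, 3 * n)) [0..<n]) + mset (map (\<lambda>x. (x, 3 * n)) (map ((+) n) [0..<n]))"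
  proof -
    have "(\<Sum>i\<leftarrow>xs. {#(i, 3 * n), (n + i, 3 * n)#}) =
       mset (map (\<lambda>x. (x, 3 * n)) xs) + mset (map (\<lambda>x. (x, 3 * n)) (map ((+) n) xs))" for xs
      by (induction xs) auto
    then show ?thesis by blast
  qed
  also have "map ((+) n) [0..<n] = [n..<2 * n]"
    unfolding mult_2 map_add_upt[of n n, symmetric] by (rule map_cong) auto
  also have "mset (map (\<lambda>x. (x, 3 * n)) [0..<n]) + mset (map (\<lambda>x. (x, 3 * n)) [n..<2 * n]) = mset (star n)"
    unfolding star_def mset_append[symmetric] map_append[symmetric]
    using upt_add_eq_append[of 0 n n] by (simp add: mult_2)
  finally show ?thesis .
qed

lemma length_sel: "length (sel n True u v) + length (sel n False u v) = 2 * n"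
  using arg_cong[OF mset_sel[of n u v], of size] by (simp add: star_def)

lemma length_predicted: "length (predicted n M) = n * n + n * (4 * n + 1)"
  by (simp add: predicted_def predicted_round_def star_def mat_edges_def length_concat sum_list_replicate)

lemma div_mod_less_square: "a < n * n \<Longrightarrow> a div n < n \<and> a mod n < (n :: nat)"
  by (metis less_mult_imp_div_less mod_less_divisor mult_zero_left not_gr_zero not_less_zero)

lemma valid_predicted:
  assumes "r \<in> set (predicted n M)"
  shows "valid_request (3 * n + 1) r"
proof -
  have "valid_request (3 * n + 1) (upd (mat_edge n M a))" if "a < n * n" for a
    using div_mod_less_square[OF that] by (auto simp: valid_request_def upd_def mat_edge_def)
  moreover have "\<forall>x<2 * n. valid_request (3 * n + 1) (upd (x, 3 * n))"
    by (auto simp: valid_request_def upd_def)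
  moreover have "valid_request (3 * n + 1) Query"
    by (auto simp: valid_request_def)
  ultimately show ?thesis using assms
    by (cases "n = 0") (auto simp: predicted_def mat_edges_def predicted_round_def star_def)
qed

text \<open>The matrix updates are predicted exactly, and every round is permuted within its own
  \<open>4 * n + 1\<close> positions. Displacements therefore do not accumulate over the
  rounds.\<close>

lemma predicted_delayed_for_requests:
  assumes "length uvs = n" "4 * n \<le> d"
  shows "delayed_for d (predicted n M) {requests n M uvs}"
proof -
  have "delayed_for d (predicted_round n) {round_requests n u v}" for u v
  proof (rule delayed_for_mset_eq)
    show "mset (predicted_round n) = mset (round_requests n u v)"
      by (simp add: predicted_round_def round_requests_def mset_sel[of n u v, symmetric])
    show "length (round_requests n u v) \<le> d + 1"
      using length_sel[of n u v] assms(2) by (simp add: round_requests_def star_def)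
  qed
  then have "list_all2 (\<lambda>xs' xs. delayed_for d xs' {xs}) (replicate n (predicted_round n))
      (map (\<lambda>(u, v). round_requests n u v) uvs)"
    using assms by (auto simp: list_all2_conv_all_nth split: prod.split)
  then show ?thesis unfolding predicted_def requests_def
    by (intro delayed_for_append delayed_for_refl delayed_for_concat)
qed

section \<open>The graph of the matrix and the triangles at the source\<close>

definition mat_graph :: "nat \<Rightarrow> bool_mat \<Rightarrow> graph" where
  "mat_graph n M = edge ` set (mat_edges n M)"

lemma edge_eq_iff: "edge (a, b) = edge (c, d) \<longleftrightarrow> a = c \<and> b = d \<or> a = d \<and> b = c"
  by (auto simp: edge_def doubleton_eq_iff)

text \<open>Flipping distinct edges in the empty graph inserts them. The edges are distinct because
  the endpoint below \<open>n\<close> is the row, while the other endpoint determines the column, be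
  it a column vertex or a dummy.\<close>

lemma flips_mat_edges: "flips (mat_edges n M) {} = mat_graph n M"
proof -
  have "inj_on (\<lambda>a. edge (mat_edge n M a)) {..<n * n}"
  proof (rule inj_onI)
    fix a b assume ab: "a \<in> {..<n * n}" "b \<in> {..<n * n}"
      and eq: "edge (mat_edge n M a) = edge (mat_edge n M b)"
    have inj: "i = i' \<and> j = j'" if "i < n" "j < n" "i' < n" "j' < n"
      "edge (i, if M i j then n + j else 2 * n + j) = edge (i', if M i' j' then n + j' else 2 * n + j')"
      for i j i' j' using that by (auto simp: edge_eq_iff split: if_splits)
    have "a div n = b div n \<and> a mod n = b mod n"
      by (rule inj[OF _ _ _ _ eq[unfolded mat_edge_def]]) (use ab div_mod_less_square[of a n] div_mod_less_square[of b n] in auto)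
    then show "a = b" by (metis div_mult_mod_eq)
  qed
  then have "distinct (map edge (mat_edges n M))"
    unfolding mat_edges_def map_map distinct_map o_def by (simp add: lessThan_atLeast0)
  then show ?thesis by (simp add: flips_distinct mat_graph_def)
qed

lemma mat_graph_iff:
  "e \<in> mat_graph n M \<longleftrightarrow> (\<exists>i<n. \<exists>j<n. e = {i, if M i j then n + j else 2 * n + j})"
proof
  assume "e \<in> mat_graph n M"
  then obtain a where "a < n * n" "e = edge (mat_edge n M a)"
    by (auto simp: mat_graph_def mat_edges_def)
  then show "\<exists>i<n. \<exists>j<n. e = {i, if M i j then n + j else 2 * n + j}"
    using div_mod_less_square[of a n] by (auto simp: mat_edge_def edge_def)
next
  assume "\<exists>i<n. \<exists>j<n. e = {i, if M i j then n + j else 2 * n + j}"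
  then obtain i j where ij: "i < n" "j < n" "e = {i, if M i j then n + j else 2 * n + j}" by blast
  have "i * n + j < n * n"
    using mult_le_mono1[of "Suc i" n n] ij(1,2) by simp
  moreover have "e = edge (mat_edge n M (i * n + j))"
    using ij by (simp add: mat_edge_def edge_def)
  ultimately show "e \<in> mat_graph n M" by (auto simp: mat_graph_def mat_edges_def)
qed

lemma set_sel:
  "edge ` set (sel n b u v) = {{i, 3 * n} | i. i < n \<and> u i = b} \<union> {{n + i, 3 * n} | i. i < n \<and> v i = b}"
proof -
  have "e \<in> edge ` set (sel_at n b u v i) \<longleftrightarrow>
    e = {i, 3 * n} \<and> u i = b \<or> e = {n + i, 3 * n} \<and> v i = b" for e i
    by (auto simp: sel_at_def edge_def)
  moreover have "edge ` set (sel n b u v) = (\<Union>i<n. edge ` set (sel_at n b u v i))"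
    by (simp add: sel_def image_UN lessThan_atLeast0)
  ultimately show ?thesis by (intro set_eqI) (simp only: UN_iff Un_iff mem_Collect_eq lessThan_iff, blast)
qed

lemma distinct_sel: "distinct (map edge (sel n b u v))"
proof -
  have "distinct (star n)" by (auto simp: star_def distinct_map inj_on_def)
  \<comment> \<open>Together the two selections are a rearrangement of the star, from which they
    inherit distinctness.\<close>
  then have "distinct (sel n True u v @ sel n False u v)"
    using mset_eq_imp_distinct_iff[of "sel n True u v @ sel n False u v" "star n"] mset_sel by simp
  then have "distinct (sel n b u v)" by (cases b) auto
  moreover have "inj_on edge (set (sel n b u v))"
    by (auto simp: inj_on_def sel_def sel_at_def edge_eq_iff split: if_splits)
  ultimately show ?thesis by (simp add: distinct_map)
qed

lemma flips_sel:
  "flips (sel n True u v) (mat_graph n M) = mat_graph n M \<union> edge ` set (sel n True u v)"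
proof (rule flips_distinct[OF distinct_sel])
  have "3 * n \<notin> e" if "e \<in> mat_graph n M" for e
    using that by (auto simp: mat_graph_iff split: if_splits)
  then show "edge ` set (sel n True u v) \<inter> mat_graph n M = {}"
    by (auto simp: set_sel)
qed

text \<open>The selected and the remaining edges make up one copy of the star, and the final pass is
  a second copy, so every edge at the source is flipped exactly twice.\<close>

lemma flips_round:
  "flips (star n) (flips (sel n False u v) (flips (sel n True u v) G)) = G"
  unfolding flips_append[symmetric] by (rule flips_even[of _ "mset (star n)"]) (simp add: mset_sel)

lemma triangles_at_iff:
  "card (triangles_at (3 * n + 1) (3 * n) (mat_graph n M \<union> edge ` set (sel n True u v))) > 0 \<longleftrightarrow>
   uMv n M u v" (is "card (triangles_at _ _ ?G) > 0 \<longleftrightarrow> _")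
proof -
  define s where "s = 3 * n"
  have "finite (triangles_at (3 * n + 1) s ?G)"
    by (rule finite_subset[of _ "Pow {..<3 * n + 1}"]) (auto simp: triangles_at_def)
  then have "card (triangles_at (3 * n + 1) s ?G) > 0 \<longleftrightarrow> triangles_at (3 * n + 1) s ?G \<noteq> {}"
    by (simp add: card_gt_0_iff)
  also have "\<dots> \<longleftrightarrow> uMv n M u v"
  proof
    assume "uMv n M u v"
    then obtain i j where ij: "i < n" "j < n" "u i" "M i j" "v j" by (auto simp: uMv_def)
    have E: "{i, n + j} \<in> ?G" "{i, s} \<in> ?G" "{n + j, s} \<in> ?G"
      using ij by (auto simp: mat_graph_iff set_sel s_def)
    have "{i, n + j, s} \<in> triangles_at (3 * n + 1) s ?G"
      unfolding triangles_at_def using E ij(1,2)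
      by (auto simp: s_def insert_commute card_insert_if)
    then show "triangles_at (3 * n + 1) s ?G \<noteq> {}" by blast
  next
    assume "triangles_at (3 * n + 1) s ?G \<noteq> {}"
    then obtain S where "S \<in> triangles_at (3 * n + 1) s ?G" by blast
    then have S: "card S = 3" "s \<in> S" "\<And>x y. x \<in> S \<Longrightarrow> y \<in> S \<Longrightarrow> x \<noteq> y \<Longrightarrow> {x, y} \<in> ?G"
      unfolding triangles_at_def by blast+
    have "card (S - {s}) = 2" using S by simp
    then obtain x y where xy: "S - {s} = {x, y}" "x \<noteq> y" by (auto simp: card_2_iff)
    have ne: "x \<in> S" "y \<in> S" "x \<noteq> s" "y \<noteq> s" using xy by auto
    have not_s: "s \<notin> e" if "e \<in> mat_graph n M" for e
      using that by (auto simp: mat_graph_iff s_def split: if_splits)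
    have adj: "(w < n \<and> u w) \<or> (\<exists>j<n. w = n + j \<and> v j)" if "w \<in> S" "w \<noteq> s" for w
    proof -
      have "{w, s} \<in> ?G" using S(2,3) that by blast
      moreover have "{w, s} \<notin> mat_graph n M" using not_s by blast
      ultimately show ?thesis
        using that(2) by (auto simp: set_sel s_def doubleton_eq_iff)
    qed
    \<comment> \<open>The edge opposite to the source avoids it, whereas all edges added by the
      selection contain it.\<close>
    have "{x, y} \<in> mat_graph n M"
      using S(3)[OF ne(1,2) xy(2)] ne by (auto simp: set_sel s_def)
    then obtain i j where ij: "i < n" "j < n" "{x, y} = {i, if M i j then n + j else 2 * n + j}"
      by (auto simp: mat_graph_iff)
    \<comment> \<open>Both endpoints are neighbours of the source. Hence the endpoint in the upper
      blocks is no dummy, which leaves only the case that the entry \<open>M i j\<close> is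
      set.\<close>
    have "u i \<and> M i j \<and> v j"
      using ij(3) adj[OF ne(1,3)] adj[OF ne(2,4)] ij(1,2)
      by (auto simp: doubleton_eq_iff split: if_splits)
    then show "uMv n M u v" using ij(1,2) by (auto simp: uMv_def)
  qed
  finally show ?thesis by (simp add: s_def)
qed

text \<open>Every round starts and ends with the graph of the matrix, so the induction over the
  pairs keeps the graph fixed. Of each count only its positivity is retained.\<close>

lemma correct_answers_requests:
  "map (\<lambda>a. of_bool (0 < a)) (correct_answers (3 * n + 1) (3 * n) {} (requests n M uvs)) =
   map (\<lambda>(u, v). of_bool (uMv n M u v)) uvs"
proof -
  have "map (\<lambda>a. of_bool (0 < a)) (correct_answers (3 * n + 1) (3 * n) (mat_graph n M)
      (concat (map (\<lambda>(u, v). round_requests n u v) uvs))) = map (\<lambda>(u, v). of_bool (uMv n M u v)) uvs"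
  proof (induction uvs)
    case (Cons uv uvs)
    obtain u v where uv: "uv = (u, v)" by (cases uv)
    have "correct_answers (3 * n + 1) (3 * n) (mat_graph n M) (round_requests n u v @ \<rho>) =
      card (triangles_at (3 * n + 1) (3 * n) (mat_graph n M \<union> edge ` set (sel n True u v))) #
      correct_answers (3 * n + 1) (3 * n) (mat_graph n M) \<rho>" for \<rho>
      unfolding round_requests_def append_assoc append_Cons correct_answers_updates
        correct_answers.simps flips_round by (simp add: flips_sel)
    then show ?case using Cons triangles_at_iff[of n M u v] by (simp add: uv)
  qed simp
  then show ?thesis by (simp add: requests_def correct_answers_updates flips_mat_edges)
qed

subsection \<open>Simulating the rounds\<close>

text \<open>A weakest precondition for total correctness whose postcondition also receives the
  number of steps. Running time and effect are thus established in the same pass.\<close>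

definition wp :: "nat \<Rightarrow> com \<Rightarrow> (nat \<Rightarrow> store \<Rightarrow> bool) \<Rightarrow> store \<Rightarrow> bool" where
  "wp W c P \<sigma> \<longleftrightarrow> (\<exists>t \<sigma>'. exec W c \<sigma> t \<sigma>' \<and> P t \<sigma>')"

inductive_cases exec_SkipE: "exec W Skip \<sigma> t \<sigma>'"
inductive_cases exec_ConstE: "exec W (Const x k) \<sigma> t \<sigma>'"
inductive_cases exec_BinE: "exec W (Bin x f y z) \<sigma> t \<sigma>'"
inductive_cases exec_LoadE: "exec W (Load x a i) \<sigma> t \<sigma>'"
inductive_cases exec_StoreE: "exec W (Store a i x) \<sigma> t \<sigma>'"
inductive_cases exec_SeqE: "exec W (Seq c d) \<sigma> t \<sigma>'"
inductive_cases exec_IfE: "exec W (If x c d) \<sigma> t \<sigma>'"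

lemma wp_Skip [simp]: "wp W Skip P \<sigma> \<longleftrightarrow> P 1 \<sigma>"
  unfolding wp_def by (metis exec_SkipE exec.Skip)

lemma wp_Const [simp]: "wp W (Const x k) P \<sigma> \<longleftrightarrow> k \<le> W \<and> P 1 (\<sigma>\<lparr>reg := (reg \<sigma>)(x := k)\<rparr>)"
  unfolding wp_def by (metis exec_ConstE exec.Const)

lemma wp_Bin [simp]: "wp W (Bin x f y z) P \<sigma> \<longleftrightarrow> binop_val f (reg \<sigma> y) (reg \<sigma> z) \<le> W \<and>
   P 1 (\<sigma>\<lparr>reg := (reg \<sigma>)(x := binop_val f (reg \<sigma> y) (reg \<sigma> z))\<rparr>)"
  unfolding wp_def by (metis exec_BinE exec.Bin)

lemma wp_Load [simp]:
  "wp W (Load x a i) P \<sigma> \<longleftrightarrow> P 1 (\<sigma>\<lparr>reg := (reg \<sigma>)(x := arr \<sigma> a (reg \<sigma> i))\<rparr>)"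
  unfolding wp_def by (metis exec_LoadE exec.Load)

lemma wp_Store [simp]: "wp W (Store a i x) P \<sigma> \<longleftrightarrow>
   P 1 (\<sigma>\<lparr>arr := (arr \<sigma>)(a := (arr \<sigma> a)(reg \<sigma> i := reg \<sigma> x))\<rparr>)"
  unfolding wp_def by (metis exec_StoreE exec.Store)

lemma wp_Seq [simp]: "wp W (Seq c d) P \<sigma> \<longleftrightarrow> wp W c (\<lambda>t. wp W d (\<lambda>t'. P (t + t'))) \<sigma>"
  unfolding wp_def by (metis exec_SeqE exec.Seq)

lemma wp_If [simp]: "wp W (If x c d) P \<sigma> \<longleftrightarrow>
   (if reg \<sigma> x \<noteq> 0 then wp W c (\<lambda>t. P (1 + t)) \<sigma> else wp W d (\<lambda>t. P (1 + t)) \<sigma>)"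
proof
  assume "wp W (If x c d) P \<sigma>"
  then obtain t \<sigma>' where "exec W (If x c d) \<sigma> t \<sigma>'" "P t \<sigma>'" by (auto simp: wp_def)
  then show "if reg \<sigma> x \<noteq> 0 then wp W c (\<lambda>t. P (1 + t)) \<sigma> else wp W d (\<lambda>t. P (1 + t)) \<sigma>"
    unfolding wp_def by (elim exec_IfE) auto
next
  assume "if reg \<sigma> x \<noteq> 0 then wp W c (\<lambda>t. P (1 + t)) \<sigma> else wp W d (\<lambda>t. P (1 + t)) \<sigma>"
  then show "wp W (If x c d) P \<sigma>"
    unfolding wp_def using exec.IfTrue[of \<sigma> x W c _ _ d] exec.IfFalse[of \<sigma> x W d _ _ c]
    by (cases "reg \<sigma> x = 0") (simp_all, blast+)
qed

lemma wp_mono: "wp W c P \<sigma> \<Longrightarrow> (\<And>t \<sigma>'. P t \<sigma>' \<Longrightarrow> Q t \<sigma>') \<Longrightarrow> wp W c Q \<sigma>"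
  unfolding wp_def by blast

definition for_loop :: "name \<Rightarrow> com \<Rightarrow> com" where
  "for_loop bnd c = Seq (Const ''x'' 0) (Seq (Bin ''go'' Less ''x'' bnd)
     (While ''go'' (Seq c (Seq (Bin ''x'' Add ''x'' ''one'') (Bin ''go'' Less ''x'' bnd)))))"

text \<open>The time recorded in \<open>J\<close> is that of the bodies alone. Each pass adds the
  loop test, the increment and the comparison; the initialization takes two steps and the last,
  failing test one, hence \<open>3 * m + 3\<close>.\<close>

lemma wp_for_loop:
  assumes J_regs: "\<And>i t \<tau>. J i t \<tau> \<Longrightarrow> reg \<tau> bnd = m \<and> reg \<tau> ''one'' = 1"
    and J_counter: "\<And>i t \<tau> a b. J i t \<tau> \<Longrightarrow> J i t (\<tau>\<lparr>reg := (reg \<tau>)(''x'' := a, ''go'' := b)\<rparr>)"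
    and body: "\<And>i t \<tau>. i < m \<Longrightarrow> J i t \<tau> \<Longrightarrow> reg \<tau> ''x'' = i \<Longrightarrow>
      wp W c (\<lambda>t' \<tau>'. reg \<tau>' ''x'' = i \<and> J (Suc i) (t + t') \<tau>') \<tau>"
    and init: "J 0 0 \<sigma>" and bnd: "bnd \<noteq> ''x''" "bnd \<noteq> ''go''" and W: "m \<le> W" "1 \<le> W"
  shows "wp W (for_loop bnd c) (\<lambda>t \<tau>. \<exists>t0. t = t0 + 3 * m + 3 \<and> J m t0 \<tau>) \<sigma>"
proof -
  let ?c = "Seq c (Seq (Bin ''x'' Add ''x'' ''one'') (Bin ''go'' Less ''x'' bnd))"
  \<comment> \<open>Induction from \<open>i = m\<close> downwards; \<open>t\<close> is the time
    already spent in the bodies of earlier passes.\<close>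
  have loop: "wp W (While ''go'' ?c) (\<lambda>t' \<tau>'. \<exists>t0. t + t' = t0 + 3 * (m - i) + 1 \<and> J m t0 \<tau>') \<tau>"
    if "i \<le> m" "J i t \<tau>" "reg \<tau> ''x'' = i" "reg \<tau> ''go'' = of_bool (i < m)" for i t \<tau>
    using that
  proof (induction i arbitrary: t \<tau> rule: inc_induct)
    case base
    then have "exec W (While ''go'' ?c) \<tau> 1 \<tau>" by (intro exec.WhileFalse) simp
    with base show ?case unfolding wp_def by (intro exI[of _ 1] exI[of _ \<tau>]) auto
  next
    case (step i)
    from body[OF step.hyps(2) step.prems(1,2)] obtain t1 \<tau>1 where
      1: "exec W c \<tau> t1 \<tau>1" "reg \<tau>1 ''x'' = i" "J (Suc i) (t + t1) \<tau>1"
      unfolding wp_def by blast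
    define \<tau>2 where "\<tau>2 = \<tau>1\<lparr>reg := (reg \<tau>1)(''x'' := Suc i, ''go'' := of_bool (Suc i < m))\<rparr>"
    have "wp W ?c (\<lambda>t' \<tau>'. t' = t1 + 2 \<and> \<tau>' = \<tau>2) \<tau>"
    proof -
      have "wp W (Seq (Bin ''x'' Add ''x'' ''one'') (Bin ''go'' Less ''x'' bnd))
          (\<lambda>t' \<tau>'. t1 + t' = t1 + 2 \<and> \<tau>' = \<tau>2) \<tau>1"
        using 1(2) J_regs[OF 1(3)] bnd W step.hyps(2) by (simp add: \<tau>2_def)
      then show ?thesis using 1(1) unfolding wp_Seq[of W c] by (subst wp_def) blast
    qed
    then have 2: "exec W ?c \<tau> (t1 + 2) \<tau>2" by (auto simp: wp_def)
    have "J (Suc i) (t + t1) \<tau>2" unfolding \<tau>2_def by (rule J_counter[OF 1(3)])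
    from step.IH[OF this] obtain t3 \<tau>3 t0 where
      3: "exec W (While ''go'' ?c) \<tau>2 t3 \<tau>3" "t + t1 + t3 = t0 + 3 * (m - Suc i) + 1" "J m t0 \<tau>3"
      unfolding wp_def by (auto simp: \<tau>2_def)
    have "exec W (While ''go'' ?c) \<tau> (1 + (t1 + 2) + t3) \<tau>3"
      by (rule exec.WhileTrue[OF _ 2 3(1)]) (use step in simp)
    moreover have "t + (1 + (t1 + 2) + t3) = t0 + 3 * (m - i) + 1"
      using 3(2) step.hyps(2) by simp
    ultimately show ?case unfolding wp_def using 3(3) by blast
  qed
  define \<sigma>1 where "\<sigma>1 = \<sigma>\<lparr>reg := (reg \<sigma>)(''x'' := 0, ''go'' := of_bool (0 < m))\<rparr>"
  have "wp W (While ''go'' ?c) (\<lambda>t' \<tau>'. \<exists>t0. 0 + t' = t0 + 3 * (m - 0) + 1 \<and> J m t0 \<tau>') \<sigma>1"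
    by (rule loop) (use J_counter[OF init] in \<open>simp_all add: \<sigma>1_def\<close>)
  then have "wp W (While ''go'' ?c) (\<lambda>t' \<tau>'. \<exists>t0. 1 + (1 + t') = t0 + 3 * m + 3 \<and> J m t0 \<tau>') \<sigma>1"
    by (rule wp_mono) auto
  then show ?thesis using J_regs[OF init] bnd W
    by (simp add: for_loop_def \<sigma>1_def)
qed

text \<open>No name of the OuMv interface and no register of the reduction itself starts with the letter z.\<close>

definition tag :: "name \<Rightarrow> name" where
  "tag x = CHR ''z'' # x"

lemma inj_tag: "inj tag"
  by (simp add: inj_def tag_def)

lemma tag_eq [simp]:
  "tag x = tag y \<longleftrightarrow> x = y" "tag x = c # cs \<longleftrightarrow> c = CHR ''z'' \<and> x = cs"
  "c # cs = tag x \<longleftrightarrow> c = CHR ''z'' \<and> x = cs"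
  by (auto simp: tag_def)

lemma in_range_tag [simp]: "c # cs \<in> range tag \<longleftrightarrow> c = CHR ''z''"
  by auto

lemma comp_tag_upd [simp]:
  "g(tag x := v) \<circ> tag = (g \<circ> tag)(x := v)"
  "c \<noteq> CHR ''z'' \<Longrightarrow> g(c # cs := v) \<circ> tag = g \<circ> tag"
  by (auto simp: fun_eq_iff)

lemma wp_rename:
  assumes "exec W c (pull tag \<tau>) t \<sigma>" "W \<le> W'"
    and "\<And>\<tau>'. pull tag \<tau>' = \<sigma> \<Longrightarrow> same_outside (range tag) \<tau> \<tau>' \<Longrightarrow> P t \<tau>'"
  shows "wp W' (rename tag c) P \<tau>"
  using exec_rename[OF assms(1) inj_tag assms(2) refl] assms(3) unfolding wp_def by blast

text \<open>In contrast to \<open>dyn_serve\<close>, this exposes the store reached after a block of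
  updates and adds up their times, so a loop of the reduction can be matched with the block that it
  issues.\<close>

fun updates :: "dyn_alg \<Rightarrow> nat \<Rightarrow> store \<Rightarrow> (nat \<times> nat) list \<Rightarrow> nat \<Rightarrow> store \<Rightarrow> bool" where
  "updates A W \<sigma> [] t \<sigma>' \<longleftrightarrow> t = 0 \<and> \<sigma>' = \<sigma>"
| "updates A W \<sigma> (e # es) t \<sigma>' \<longleftrightarrow> (\<exists>t1 t2 \<sigma>1. t = t1 + t2 \<and>
     exec W (dyn_update A) (update_input (fst e) (snd e) \<sigma>) t1 \<sigma>1 \<and> updates A W \<sigma>1 es t2 \<sigma>')"

lemma updates_append:
  "updates A W \<sigma> (es @ fs) t \<sigma>' \<longleftrightarrow>
   (\<exists>t1 t2 \<sigma>1. t = t1 + t2 \<and> updates A W \<sigma> es t1 \<sigma>1 \<and> updates A W \<sigma>1 fs t2 \<sigma>')"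
proof (induction es arbitrary: \<sigma> t)
  case (Cons e es)
  show ?case
  proof
    assume "updates A W \<sigma> ((e # es) @ fs) t \<sigma>'"
    then show "\<exists>t1 t2 \<sigma>1. t = t1 + t2 \<and> updates A W \<sigma> (e # es) t1 \<sigma>1 \<and> updates A W \<sigma>1 fs t2 \<sigma>'"
      using Cons by simp (metis add.assoc)
  next
    assume "\<exists>t1 t2 \<sigma>1. t = t1 + t2 \<and> updates A W \<sigma> (e # es) t1 \<sigma>1 \<and> updates A W \<sigma>1 fs t2 \<sigma>'"
    then show "updates A W \<sigma> ((e # es) @ fs) t \<sigma>'"
      using Cons by simp (metis add.assoc)
  qed
qed simp

inductive_cases dyn_serve_ConsE: "dyn_serve A W \<sigma> (r # \<rho>) ts as"

lemma dyn_serve_updates: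
  assumes "dyn_serve A W \<sigma> (map upd es @ \<rho>) ts as"
  shows "\<exists>ts1 ts2 \<sigma>'. ts = ts1 @ ts2 \<and> length ts1 = length es \<and>
    updates A W \<sigma> es (sum_list ts1) \<sigma>' \<and> dyn_serve A W \<sigma>' \<rho> ts2 as"
  using assms
proof (induction es arbitrary: \<sigma> ts)
  case (Cons e es)
  then obtain t \<sigma>1 ts' where 1: "ts = t # ts'"
    "exec W (dyn_update A) (update_input (fst e) (snd e) \<sigma>) t \<sigma>1"
    "dyn_serve A W \<sigma>1 (map upd es @ \<rho>) ts' as"
    by (auto elim!: dyn_serve_ConsE simp: upd_def[of e])
  from Cons.IH[OF 1(3)] obtain ts1 ts2 \<sigma>' where 2: "ts' = ts1 @ ts2" "length ts1 = length es"
    "updates A W \<sigma>1 es (sum_list ts1) \<sigma>'" "dyn_serve A W \<sigma>' \<rho> ts2 as" by blast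
  with 1 show ?case by (intro exI[of _ "t # ts1"] exI[of _ ts2] exI[of _ \<sigma>']) auto
qed simp

text \<open>The names of the reduction itself that must survive the calls of the simulated
  algorithm. Register \<open>''nil''\<close> is never written and stays 0, so adding it copies a
  register. The answer is included because the flips after the query must not disturb it.\<close>

definition ctx :: "nat \<Rightarrow> (nat \<Rightarrow> nat) \<Rightarrow> (nat \<Rightarrow> nat) \<Rightarrow> (nat \<Rightarrow> nat) \<Rightarrow> nat \<Rightarrow> store \<Rightarrow> bool" where
  "ctx n M u v a \<tau> \<longleftrightarrow> reg \<tau> ''n'' = n \<and> reg \<tau> ''one'' = 1 \<and> reg \<tau> ''nil'' = 0 \<and>
     reg \<tau> ''nn'' = n * n \<and> reg \<tau> ''dn'' = 2 * n \<and> reg \<tau> ''src'' = 3 * n \<and>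
     arr \<tau> ''M'' = M \<and> arr \<tau> ''u'' = u \<and> arr \<tau> ''v'' = v \<and> reg \<tau> ''answer'' = a"

lemma ctx_same_outside: "same_outside (range tag) \<tau> \<tau>' \<Longrightarrow> ctx n M u v a \<tau> \<Longrightarrow> ctx n M u v a \<tau>'"
  by (simp add: ctx_def same_outside_def)

lemma same_outside_reg: "same_outside (range tag) \<tau> \<tau>' \<Longrightarrow> c \<noteq> CHR ''z'' \<Longrightarrow> reg \<tau>' (c # cs) = reg \<tau> (c # cs)"
  by (simp add: same_outside_def)

definition update_call :: "dyn_alg \<Rightarrow> name \<Rightarrow> name \<Rightarrow> com" where
  "update_call A y v = Seq (Bin (tag ''u'') Add y ''nil'')
     (Seq (Bin (tag ''v'') Add v ''nil'') (rename tag (dyn_update A)))"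

lemma wp_update_call:
  assumes "exec W (dyn_update A) (update_input (reg \<tau> y) (reg \<tau> v) (pull tag \<tau>)) t \<sigma>" "W \<le> W'"
    and "reg \<tau> ''nil'' = 0" "reg \<tau> y \<le> W'" "reg \<tau> v \<le> W'" "v \<notin> range tag"
    and post: "\<And>\<tau>'. pull tag \<tau>' = \<sigma> \<Longrightarrow> same_outside (range tag) \<tau> \<tau>' \<Longrightarrow> P (t + 2) \<tau>'"
  shows "wp W' (update_call A y v) P \<tau>"
proof -
  define \<tau>1 where "\<tau>1 = \<tau>\<lparr>reg := (reg \<tau>)(tag ''u'' := reg \<tau> y, tag ''v'' := reg \<tau> v)\<rparr>"
  have pull: "pull tag \<tau>1 = update_input (reg \<tau> y) (reg \<tau> v) (pull tag \<tau>)"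
    by (simp add: \<tau>1_def pull_def update_input_def)
  have "wp W' (rename tag (dyn_update A)) (\<lambda>t. P (1 + (1 + t))) \<tau>1"
  proof (rule wp_rename[OF _ assms(2)])
    show "exec W (dyn_update A) (pull tag \<tau>1) t \<sigma>" using assms(1) pull by simp
    fix \<tau>' assume \<tau>': "pull tag \<tau>' = \<sigma>" "same_outside (range tag) \<tau>1 \<tau>'"
    have "same_outside (range tag) \<tau> \<tau>'"
      using \<tau>'(2) by (auto simp: same_outside_def \<tau>1_def)
    from post[OF \<tau>'(1) this] show "P (1 + (1 + t)) \<tau>'" by simp
  qed
  \<comment> \<open>The first copy must not overwrite the register that the second copy
    reads.\<close>
  moreover have "v \<noteq> tag ''u''" using assms(6) by auto
  ultimately show ?thesis using assms(3-5) by (simp add: update_call_def \<tau>1_def)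
qed

text \<open>The invariant describes what remains: from the present simulated store, the blocks from
  index \<open>i\<close> on still lead to \<open>\<sigma>\<close>. The total \<open>tot\<close>
  splits into the time spent and the time outstanding; \<open>k\<close> is the overhead of a pass,
  to which the counter adds 3.\<close>

lemma wp_for_loop_updates:
  assumes body: "\<And>i \<tau> t \<sigma>1. i < m \<Longrightarrow> ctx n M u v a \<tau> \<Longrightarrow> reg \<tau> ''x'' = i \<Longrightarrow>
      updates A W (pull tag \<tau>) (r i) t \<sigma>1 \<Longrightarrow>
      wp W' c (\<lambda>t' \<tau>'. t' \<le> t + k \<and> ctx n M u v a \<tau>' \<and> reg \<tau>' ''x'' = i \<and> pull tag \<tau>' = \<sigma>1) \<tau>"
    and "ctx n M u v a \<tau>0" "updates A W (pull tag \<tau>0) (concat (map r [0..<m])) tot \<sigma>"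
    and bnd: "\<And>\<tau>. ctx n M u v a \<tau> \<Longrightarrow> reg \<tau> bnd = m" "bnd \<noteq> ''x''" "bnd \<noteq> ''go''"
    and W: "m \<le> W'" "1 \<le> W'"
  shows "wp W' (for_loop bnd c) (\<lambda>t \<tau>. t \<le> tot + (k + 3) * m + 3 \<and> ctx n M u v a \<tau> \<and> pull tag \<tau> = \<sigma>) \<tau>0"
proof -
  define J where "J i t \<tau> \<longleftrightarrow> ctx n M u v a \<tau> \<and> (\<exists>t1 t2. t1 + t2 = tot \<and> t \<le> t1 + k * i \<and>
    updates A W (pull tag \<tau>) (concat (map r [i..<m])) t2 \<sigma>)" for i t \<tau>
  have "wp W' (for_loop bnd c) (\<lambda>t \<tau>. \<exists>t0. t = t0 + 3 * m + 3 \<and> J m t0 \<tau>) \<tau>0"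
  proof (rule wp_for_loop[OF _ _ _ _ bnd(2,3) W])
    show "J 0 0 \<tau>0" using assms(2,3) unfolding J_def by (intro conjI exI[of _ 0] exI[of _ tot]) auto
    show "reg \<tau> bnd = m \<and> reg \<tau> ''one'' = 1" if "J i t \<tau>" for i t \<tau>
      using that bnd(1)[of \<tau>] by (simp add: J_def ctx_def)
    show "J i t (\<tau>\<lparr>reg := (reg \<tau>)(''x'' := x, ''go'' := y)\<rparr>)" if "J i t \<tau>" for i t \<tau> x y
      using that by (simp add: J_def ctx_def pull_def)
    fix i t \<tau> assume i: "i < m" and J: "J i t \<tau>" and x: "reg \<tau> ''x'' = i"
    from J obtain t1 t2 where J': "ctx n M u v a \<tau>" "t1 + t2 = tot" "t \<le> t1 + k * i"
      "updates A W (pull tag \<tau>) (concat (map r [i..<m])) t2 \<sigma>" by (auto simp: J_def)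
    from J'(4) i obtain t3 t4 \<sigma>1 where s: "t2 = t3 + t4" "updates A W (pull tag \<tau>) (r i) t3 \<sigma>1"
      "updates A W \<sigma>1 (concat (map r [Suc i..<m])) t4 \<sigma>"
      by (auto simp: upt_conv_Cons updates_append)
    show "wp W' c (\<lambda>t' \<tau>'. reg \<tau>' ''x'' = i \<and> J (Suc i) (t + t') \<tau>') \<tau>"
    proof (rule wp_mono[OF body[OF i J'(1) x s(2)]])
      fix t' \<tau>' assume *: "t' \<le> t3 + k \<and> ctx n M u v a \<tau>' \<and> reg \<tau>' ''x'' = i \<and> pull tag \<tau>' = \<sigma>1"
      have "(t1 + t3) + t4 = tot" "t + t' \<le> (t1 + t3) + k * Suc i"
        using J'(2,3) s(1) * by auto
      then show "reg \<tau>' ''x'' = i \<and> J (Suc i) (t + t') \<tau>'"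
        using * s(3) unfolding J_def by blast
    qed
  qed
  then show ?thesis
    by (rule wp_mono) (auto simp: J_def algebra_simps)
qed

section \<open>The program for one OuMv round\<close>

definition guarded :: "bool \<Rightarrow> com \<Rightarrow> com" where
  "guarded b c = (if b then If ''c'' c Skip else If ''c'' Skip c)"

lemma wp_guarded:
  "wp W (guarded b c) P \<tau> \<longleftrightarrow> (if (reg \<tau> ''c'' \<noteq> 0) = b then wp W c (\<lambda>t. P (1 + t)) \<tau> else P 2 \<tau>)"
  by (auto simp: guarded_def numeral_2_eq_2)

definition sel_body :: "dyn_alg \<Rightarrow> bool \<Rightarrow> com" where
  "sel_body A b = Seq (Load ''c'' ''u'' ''x'') (Seq (guarded b (update_call A ''x'' ''src''))
     (Seq (Bin ''a'' Add ''n'' ''x'') (Seq (Load ''c'' ''v'' ''x'') (guarded b (update_call A ''a'' ''src'')))))"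

text \<open>Two loads, one addition, two tests and two copies for each issued update make at most
  nine steps of overhead; the constant 11 leaves some slack.\<close>

lemma wp_sel_body:
  assumes i: "i < n" "reg \<tau> ''x'' = i" and ctx: "ctx n M (vec_array n u) (vec_array n v) a \<tau>"
    and upds: "updates A W (pull tag \<tau>) (sel_at n b u v i) t \<sigma>"
    and W: "W \<le> W'" "3 * n \<le> W'"
  shows "wp W' (sel_body A b) (\<lambda>t' \<tau>'. t' \<le> t + 11 \<and>
    ctx n M (vec_array n u) (vec_array n v) a \<tau>' \<and> reg \<tau>' ''x'' = i \<and> pull tag \<tau>' = \<sigma>) \<tau>"
proof -
  let ?ctx = "ctx n M (vec_array n u) (vec_array n v) a"
  from upds obtain t1 t2 \<sigma>1 where t: "t = t1 + t2"
    and 1: "updates A W (pull tag \<tau>) (if u i = b then [(i, 3 * n)] else []) t1 \<sigma>1"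
    and 2: "updates A W \<sigma>1 (if v i = b then [(n + i, 3 * n)] else []) t2 \<sigma>"
    unfolding sel_at_def updates_append by blast
  have first: "wp W' (Seq (Load ''c'' ''u'' ''x'') (guarded b (update_call A ''x'' ''src'')))
      (\<lambda>t' \<tau>'. t' \<le> t1 + 4 \<and> ?ctx \<tau>' \<and> reg \<tau>' ''x'' = i \<and> pull tag \<tau>' = \<sigma>1) \<tau>"
  proof (cases "u i = b")
    case True
    define \<tau>1 where "\<tau>1 = \<tau>\<lparr>reg := (reg \<tau>)(''c'' := of_bool (u i))\<rparr>"
    have \<tau>1: "?ctx \<tau>1" "reg \<tau>1 ''x'' = i" "reg \<tau>1 ''src'' = 3 * n" "reg \<tau>1 ''nil'' = 0"
      "pull tag \<tau>1 = pull tag \<tau>"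
      using ctx i by (simp_all add: \<tau>1_def ctx_def pull_def)
    have "wp W' (update_call A ''x'' ''src'')
      (\<lambda>t' \<tau>'. 1 + (1 + t') \<le> t1 + 4 \<and> ?ctx \<tau>' \<and> reg \<tau>' ''x'' = i \<and> pull tag \<tau>' = \<sigma>1) \<tau>1"
      by (rule wp_update_call[OF _ W(1), of A _ _ _ t1 \<sigma>1])
         (use 1 True \<tau>1 i W in \<open>auto simp: same_outside_reg intro: ctx_same_outside\<close>)
    then show ?thesis using i ctx True
      by (simp add: wp_guarded \<tau>1_def ctx_def vec_array_def)
  next
    case False
    then show ?thesis using i ctx 1
      by (simp add: wp_guarded ctx_def vec_array_def pull_def)
  qed
  have second: "wp W' (Seq (Bin ''a'' Add ''n'' ''x'')
        (Seq (Load ''c'' ''v'' ''x'') (guarded b (update_call A ''a'' ''src''))))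
      (\<lambda>t' \<tau>'. t' \<le> t2 + 5 \<and> ?ctx \<tau>' \<and> reg \<tau>' ''x'' = i \<and> pull tag \<tau>' = \<sigma>) \<tau>'"
    if \<tau>': "?ctx \<tau>'" "reg \<tau>' ''x'' = i" "pull tag \<tau>' = \<sigma>1" for \<tau>'
  proof (cases "v i = b")
    case True
    define \<tau>1 where "\<tau>1 = \<tau>'\<lparr>reg := (reg \<tau>')(''a'' := n + i, ''c'' := of_bool (v i))\<rparr>"
    have \<tau>1: "?ctx \<tau>1" "reg \<tau>1 ''x'' = i" "reg \<tau>1 ''a'' = n + i" "reg \<tau>1 ''src'' = 3 * n"
      "reg \<tau>1 ''nil'' = 0" "pull tag \<tau>1 = \<sigma>1"
      using \<tau>' i by (simp_all add: \<tau>1_def ctx_def pull_def)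
    have "wp W' (update_call A ''a'' ''src'')
      (\<lambda>t' \<tau>'. 1 + (1 + (1 + t')) \<le> t2 + 5 \<and> ?ctx \<tau>' \<and> reg \<tau>' ''x'' = i \<and> pull tag \<tau>' = \<sigma>) \<tau>1"
      by (rule wp_update_call[OF _ W(1), of A _ _ _ t2 \<sigma>])
         (use 2 True \<tau>1 i W in \<open>auto simp: same_outside_reg intro: ctx_same_outside\<close>)
    then show ?thesis using i \<tau>' True W
      by (simp add: wp_guarded \<tau>1_def ctx_def vec_array_def)
  next
    case False
    then show ?thesis using i \<tau>' 2 W
      by (simp add: wp_guarded ctx_def vec_array_def pull_def)
  qed
  have assoc: "wp W' (sel_body A b) P \<tau> \<longleftrightarrow>
    wp W' (Seq (Seq (Load ''c'' ''u'' ''x'') (guarded b (update_call A ''x'' ''src'')))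
      (Seq (Bin ''a'' Add ''n'' ''x'')
        (Seq (Load ''c'' ''v'' ''x'') (guarded b (update_call A ''a'' ''src''))))) P \<tau>" for P
    by (simp add: sel_body_def add.assoc)
  show ?thesis unfolding assoc wp_Seq[of _ "Seq (Load ''c'' ''u'' ''x'') _"]
    by (rule wp_mono[OF first], rule wp_mono[OF second]) (auto simp: t)
qed

text \<open>Comparing \<open>''nil''\<close>, which holds 0, with the simulated answer turns a
  number of triangles into a Boolean. The flips that follow belong to the same round, so the next
  pair finds the graph of the matrix again.\<close>

definition round_prog :: "dyn_alg \<Rightarrow> com" where
  "round_prog A = Seq (for_loop ''n'' (sel_body A True)) (Seq (rename tag (dyn_query A))
     (Seq (Bin ''answer'' Less ''nil'' (tag ''answer''))
       (Seq (for_loop ''n'' (sel_body A False)) (for_loop ''dn'' (update_call A ''x'' ''src'')))))"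

lemma wp_for_sel:
  assumes "ctx n M (vec_array n u) (vec_array n v) a \<tau>"
    and "updates A W (pull tag \<tau>) (sel n b u v) t \<sigma>" and W: "W \<le> W'" "3 * n + 1 \<le> W'"
  shows "wp W' (for_loop ''n'' (sel_body A b)) (\<lambda>t' \<tau>'. t' \<le> t + 14 * n + 3 \<and>
    ctx n M (vec_array n u) (vec_array n v) a \<tau>' \<and> pull tag \<tau>' = \<sigma>) \<tau>"
proof -
  have "wp W' (for_loop ''n'' (sel_body A b)) (\<lambda>t' \<tau>'. t' \<le> t + (11 + 3) * n + 3 \<and>
    ctx n M (vec_array n u) (vec_array n v) a \<tau>' \<and> pull tag \<tau>' = \<sigma>) \<tau>"
    by (rule wp_for_loop_updates[OF wp_sel_body assms(1) assms(2)[unfolded sel_def]])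
       (use W in \<open>auto simp: ctx_def\<close>)
  then show ?thesis by simp
qed

lemma wp_for_star:
  assumes "ctx n M u v a \<tau>"
    and "updates A W (pull tag \<tau>) (star n) t \<sigma>" and W: "W \<le> W'" "3 * n + 1 \<le> W'"
  shows "wp W' (for_loop ''dn'' (update_call A ''x'' ''src'')) (\<lambda>t' \<tau>'. t' \<le> t + 10 * n + 3 \<and>
    ctx n M u v a \<tau>' \<and> pull tag \<tau>' = \<sigma>) \<tau>"
proof -
  have star: "star n = concat (map (\<lambda>x. [(x, 3 * n)]) [0..<2 * n])"
    by (simp add: star_def concat_map_singleton)
  have "wp W' (for_loop ''dn'' (update_call A ''x'' ''src'')) (\<lambda>t' \<tau>'. t' \<le> t + (2 + 3) * (2 * n) + 3 \<and>
    ctx n M u v a \<tau>' \<and> pull tag \<tau>' = \<sigma>) \<tau>"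
  proof (rule wp_for_loop_updates[OF _ assms(1) assms(2)[unfolded star]])
    fix i \<tau> t \<sigma>1
    assume i: "i < 2 * n" "ctx n M u v a \<tau>" "reg \<tau> ''x'' = i" "updates A W (pull tag \<tau>) [(i, 3 * n)] t \<sigma>1"
    then show "wp W' (update_call A ''x'' ''src'')
      (\<lambda>t' \<tau>'. t' \<le> t + 2 \<and> ctx n M u v a \<tau>' \<and> reg \<tau>' ''x'' = i \<and> pull tag \<tau>' = \<sigma>1) \<tau>"
      by (intro wp_update_call[OF _ W(1), of A _ _ _ t \<sigma>1])
         (use W in \<open>auto simp: ctx_def same_outside_reg same_outside_def\<close>)
  qed (use W in \<open>auto simp: ctx_def\<close>)
  then show ?thesis by simp
qed

text \<open>The overhead is \<open>14 * n + 3\<close> for each of the two passes over the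
  selections, \<open>10 * n + 3\<close> for the pass over the star and one step for the comparison,
  in total \<open>38 * n + 10\<close>.\<close>

lemma round_prog_simulates:
  assumes ctx: "ctx n M u0 v0 a0 \<tau>"
    and serve: "dyn_serve A W (pull tag \<tau>) (round_requests n u v @ \<rho>) ts as"
    and W: "W \<le> W'" "3 * n + 1 \<le> W'"
  shows "\<exists>t \<tau>' ts1 ts2 a as2. exec W' (round_prog A) (oumv_input n u v \<tau>) t \<tau>' \<and>
    ts = ts1 @ ts2 \<and> length ts1 = length (round_requests n u v) \<and> t \<le> sum_list ts1 + 38 * n + 10 \<and>
    as = a # as2 \<and> reg \<tau>' ''answer'' = of_bool (0 < a) \<and>
    dyn_serve A W (pull tag \<tau>') \<rho> ts2 as2 \<and>
    ctx n M (vec_array n u) (vec_array n v) (of_bool (0 < a)) \<tau>'"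
proof -
  let ?ctx = "ctx n M (vec_array n u) (vec_array n v)"
  have serve': "dyn_serve A W (pull tag \<tau>) (map upd (sel n True u v) @ Query # map upd (sel n False u v @ star n) @ \<rho>) ts as"
    using serve by (simp add: round_requests_def)
  from dyn_serve_updates[OF this] obtain ts1 ts' \<sigma>1 where 1: "ts = ts1 @ ts'"
    "length ts1 = length (sel n True u v)" "updates A W (pull tag \<tau>) (sel n True u v) (sum_list ts1) \<sigma>1"
    "dyn_serve A W \<sigma>1 (Query # map upd (sel n False u v @ star n) @ \<rho>) ts' as" by blast
  from 1(4) obtain tq \<sigma>2 ts'' as' where 2: "ts' = tq # ts''" "as = reg \<sigma>2 ''answer'' # as'"
    "exec W (dyn_query A) \<sigma>1 tq \<sigma>2" "dyn_serve A W \<sigma>2 (map upd (sel n False u v @ star n) @ \<rho>) ts'' as'"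
    by (auto elim!: dyn_serve_ConsE)
  from dyn_serve_updates[OF 2(4)] obtain ts2 ts3 \<sigma>4 where 3: "ts'' = ts2 @ ts3"
    "length ts2 = length (sel n False u v @ star n)"
    "updates A W \<sigma>2 (sel n False u v @ star n) (sum_list ts2) \<sigma>4" "dyn_serve A W \<sigma>4 \<rho> ts3 as'" by blast
  from 3(3) obtain t3 t4 \<sigma>3 where 4: "sum_list ts2 = t3 + t4" "updates A W \<sigma>2 (sel n False u v) t3 \<sigma>3"
    "updates A W \<sigma>3 (star n) t4 \<sigma>4" unfolding updates_append by blast
  define a where "a = reg \<sigma>2 ''answer''"
  have ctx': "?ctx a0 (oumv_input n u v \<tau>)" "pull tag (oumv_input n u v \<tau>) = pull tag \<tau>"
    using ctx by (simp_all add: ctx_def oumv_input_def pull_def)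
  have "wp W' (round_prog A) (\<lambda>t \<tau>'. t \<le> sum_list ts1 + tq + sum_list ts2 + 38 * n + 10 \<and>
      ?ctx (of_bool (0 < a)) \<tau>' \<and> pull tag \<tau>' = \<sigma>4) (oumv_input n u v \<tau>)"
    unfolding round_prog_def wp_Seq[of _ "for_loop _ _"] wp_Seq[of _ "rename _ _"]
  proof (rule wp_mono[OF wp_for_sel[OF ctx'(1) _ W]])
    show "updates A W (pull tag (oumv_input n u v \<tau>)) (sel n True u v) (sum_list ts1) \<sigma>1"
      using 1(3) ctx'(2) by simp
    fix t1 \<tau>1 assume t1: "t1 \<le> sum_list ts1 + 14 * n + 3 \<and> ?ctx a0 \<tau>1 \<and> pull tag \<tau>1 = \<sigma>1"
    show "wp W' (rename tag (dyn_query A)) (\<lambda>t2. wp W' (Seq (Bin ''answer'' Less ''nil'' (tag ''answer''))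
       (Seq (for_loop ''n'' (sel_body A False)) (for_loop ''dn'' (update_call A ''x'' ''src''))))
       (\<lambda>t3 \<tau>'. t1 + (t2 + t3) \<le> sum_list ts1 + tq + sum_list ts2 + 38 * n + 10 \<and>
      ?ctx (of_bool (0 < a)) \<tau>' \<and> pull tag \<tau>' = \<sigma>4)) \<tau>1"
    proof (rule wp_rename[OF _ W(1)])
      show "exec W (dyn_query A) (pull tag \<tau>1) tq \<sigma>2" using t1 2(3) by simp
      fix \<tau>2 assume \<tau>2: "pull tag \<tau>2 = \<sigma>2" "same_outside (range tag) \<tau>1 \<tau>2"
      have ctx2: "?ctx a0 \<tau>2" using ctx_same_outside[OF \<tau>2(2)] t1 by blast
      have ans: "reg \<tau>2 (tag ''answer'') = a" using \<tau>2(1) by (auto simp: a_def pull_def)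
      define \<tau>3 where "\<tau>3 = \<tau>2\<lparr>reg := (reg \<tau>2)(''answer'' := of_bool (0 < a))\<rparr>"
      have \<tau>3: "?ctx (of_bool (0 < a)) \<tau>3" "pull tag \<tau>3 = \<sigma>2"
        using ctx2 \<tau>2(1) by (auto simp: \<tau>3_def ctx_def pull_def)
      have "wp W' (Seq (for_loop ''n'' (sel_body A False)) (for_loop ''dn'' (update_call A ''x'' ''src'')))
       (\<lambda>t3 \<tau>'. t1 + (tq + (1 + t3)) \<le> sum_list ts1 + tq + sum_list ts2 + 38 * n + 10 \<and>
      ?ctx (of_bool (0 < a)) \<tau>' \<and> pull tag \<tau>' = \<sigma>4) \<tau>3"
        unfolding wp_Seq
      proof (rule wp_mono[OF wp_for_sel[OF \<tau>3(1) _ W]])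
        show "updates A W (pull tag \<tau>3) (sel n False u v) t3 \<sigma>3" using 4 \<tau>3 by simp
        fix t5 \<tau>4 assume t5: "t5 \<le> t3 + 14 * n + 3 \<and> ?ctx (of_bool (0 < a)) \<tau>4 \<and> pull tag \<tau>4 = \<sigma>3"
        show "wp W' (for_loop ''dn'' (update_call A ''x'' ''src''))
          (\<lambda>t6 \<tau>'. t1 + (tq + (1 + (t5 + t6))) \<le> sum_list ts1 + tq + sum_list ts2 + 38 * n + 10 \<and>
          ?ctx (of_bool (0 < a)) \<tau>' \<and> pull tag \<tau>' = \<sigma>4) \<tau>4"
          by (rule wp_mono[OF wp_for_star[OF _ _ W]]) (use t1 t5 4 in auto)
      qed
      moreover have "reg \<tau>2 ''nil'' = 0" using ctx2 by (simp add: ctx_def)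
      ultimately show "wp W' (Seq (Bin ''answer'' Less ''nil'' (tag ''answer''))
       (Seq (for_loop ''n'' (sel_body A False)) (for_loop ''dn'' (update_call A ''x'' ''src''))))
       (\<lambda>t3 \<tau>'. t1 + (tq + t3) \<le> sum_list ts1 + tq + sum_list ts2 + 38 * n + 10 \<and>
      ?ctx (of_bool (0 < a)) \<tau>' \<and> pull tag \<tau>' = \<sigma>4) \<tau>2"
        unfolding wp_Seq[of _ "Bin _ _ _ _"] wp_Bin using W ans by (simp add: \<tau>3_def)
    qed
  qed
  then obtain t \<tau>' where "exec W' (round_prog A) (oumv_input n u v \<tau>) t \<tau>'"
    "t \<le> sum_list (ts1 @ tq # ts2) + 38 * n + 10" "?ctx (of_bool (0 < a)) \<tau>'" "pull tag \<tau>' = \<sigma>4"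
    unfolding wp_def by auto
  moreover have "ts = (ts1 @ tq # ts2) @ ts3" "length (ts1 @ tq # ts2) = length (round_requests n u v)"
    using 1 2 3 by (simp_all add: round_requests_def)
  ultimately show ?thesis using 2(2) 3(4) unfolding a_def[symmetric]
    by (intro exI[of _ t] exI[of _ \<tau>'] exI[of _ "ts1 @ tq # ts2"] exI[of _ ts3] exI[of _ a] exI[of _ as'])
       (auto simp: ctx_def)
qed

text \<open>\<open>u0\<close>, \<open>v0\<close> and \<open>a0\<close> stand for whatever the
  preprocessing or the previous round left behind, and the induction generalizes over them.\<close>

lemma rounds_simulate:
  assumes "ctx n M u0 v0 a0 \<tau>"
    and "dyn_serve A W (pull tag \<tau>) (concat (map (\<lambda>(u, v). round_requests n u v) uvs)) ts as"
    and W: "W \<le> W'" "3 * n + 1 \<le> W'" and B: "oumv_round B = round_prog A"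
  shows "\<exists>t. oumv_rounds B W' n \<tau> uvs t (map (\<lambda>a. of_bool (0 < a)) as) \<and>
    t \<le> sum_list ts + length uvs * (38 * n + 10)"
  using assms(1,2)
proof (induction uvs arbitrary: \<tau> u0 v0 a0 ts as)
  case Nil
  then have "ts = [] \<and> as = []" by (auto elim: dyn_serve.cases)
  then show ?case by (auto intro: oumv_rounds.Nil)
next
  case (Cons uv uvs)
  obtain u v where uv: "uv = (u, v)" by (cases uv)
  from round_prog_simulates[OF Cons.prems(1) _ W, of A u v "concat (map (\<lambda>(u, v). round_requests n u v) uvs)" ts as]
    Cons.prems(2) obtain t \<tau>' ts1 ts2 a as2 where
    1: "exec W' (round_prog A) (oumv_input n u v \<tau>) t \<tau>'" "ts = ts1 @ ts2"
    "t \<le> sum_list ts1 + 38 * n + 10" "as = a # as2" "reg \<tau>' ''answer'' = of_bool (0 < a)"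
    "dyn_serve A W (pull tag \<tau>') (concat (map (\<lambda>(u, v). round_requests n u v) uvs)) ts2 as2"
    "ctx n M (vec_array n u) (vec_array n v) (of_bool (0 < a)) \<tau>'"
    by (auto simp: uv)
  from Cons.IH[OF 1(7,6)] obtain t' where
    2: "oumv_rounds B W' n \<tau>' uvs t' (map (\<lambda>a. of_bool (0 < a)) as2)"
    "t' \<le> sum_list ts2 + length uvs * (38 * n + 10)" by blast
  from oumv_rounds.Cons[OF _ 2(1), of u v \<tau> t] 1(1) B 1(5)
  have "oumv_rounds B W' n \<tau> (uv # uvs) (t + t') (map (\<lambda>a. of_bool (0 < a)) as)"
    by (simp add: uv 1(4))
  moreover have "t + t' \<le> sum_list ts + length (uv # uvs) * (38 * n + 10)"
    using 1(2,3) 2(2) by simp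
  ultimately show ?case by blast
qed

subsection \<open>Simulating the preprocessing\<close>

text \<open>Used twice, to write the matrix part of the prediction and, after the simulated
  preprocessing, to issue these very updates; this keeps the predicted and the actual insertions
  identical.\<close>

definition mat_code :: com where
  "mat_code = Seq (Bin ''a'' Div ''x'' ''n'') (Seq (Load ''c'' ''M'' ''x'')
     (Seq (Bin ''b'' Mod ''x'' ''n'') (If ''c'' (Bin ''b'' Add ''n'' ''b'') (Bin ''b'' Add ''dn'' ''b''))))"

definition write_code :: "name \<Rightarrow> com" where
  "write_code y = Seq (Store (tag ''kind'') y ''one'') (Seq (Store (tag ''fst'') y ''a'')
     (Store (tag ''snd'') y ''b''))"

definition fill_mat :: com where
  "fill_mat = Seq mat_code (write_code ''x'')"

text \<open>
  Position \<open>j < 4n + 1\<close> of a predicted round is the query iff \<open>j mod (2n + 1) = 2n\<close>, and otherwise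
  flips the edge between \<open>j mod (2n + 1)\<close> and the source. Queries are encoded by zeros in all three
  arrays, so nothing is written for them.
\<close>

definition fill_rounds :: com where
  "fill_rounds = Seq (Bin ''a'' Mod ''x'' ''bl'') (Seq (Bin ''a'' Mod ''a'' ''md'')
     (Seq (Bin ''b'' Add ''src'' ''nil'') (Seq (Bin ''y'' Add ''nn'' ''x'')
     (Seq (Bin ''c'' Eq ''a'' ''dn'') (If ''c'' Skip (write_code ''y''))))))"

definition setup_regs :: com where
  "setup_regs = Seq (Const ''one'' 1) (Seq (Bin ''dn'' Add ''n'' ''n'') (Seq (Bin ''src'' Add ''dn'' ''n'')
     (Seq (Bin ''nn'' Mul ''n'' ''n'') (Seq (Bin ''md'' Add ''dn'' ''one'')
     (Seq (Bin ''bl'' Add ''dn'' ''md'') (Bin ''rl'' Mul ''n'' ''bl''))))))"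

definition setup_input :: com where
  "setup_input = Seq (Bin (tag ''n'') Add ''src'' ''one'') (Seq (Bin (tag ''s'') Add ''src'' ''nil'')
     (Bin (tag ''T'') Add ''nn'' ''rl''))"

definition prep_prog :: "dyn_alg \<Rightarrow> com" where
  "prep_prog A = Seq setup_regs (Seq (for_loop ''nn'' fill_mat) (Seq (for_loop ''rl'' fill_rounds)
     (Seq setup_input (Seq (rename tag (dyn_prep A))
       (for_loop ''nn'' (Seq mat_code (update_call A ''a'' ''b'')))))))"

text \<open>The simulated input while it is being written: the arrays of \<open>dyn_init\<close> for
  a prefix of the prediction, before any simulated register is set.\<close>

definition partial_input :: "request list \<Rightarrow> bool stream \<Rightarrow> store" where
  "partial_input \<rho> \<omega> = (zero_store \<omega>)
     \<lparr>arr := (\<lambda>_ _. 0)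
        (''kind'' := request_array (\<lambda>r. case r of Update u v \<Rightarrow> 1 | Query \<Rightarrow> 0) \<rho>,
         ''fst'' := request_array (\<lambda>r. case r of Update u v \<Rightarrow> u | Query \<Rightarrow> 0) \<rho>,
         ''snd'' := request_array (\<lambda>r. case r of Update u v \<Rightarrow> v | Query \<Rightarrow> 0) \<rho>)\<rparr>"

lemma request_array_snoc: "request_array f (xs @ [r]) = (request_array f xs)(length xs := f r)"
  by (auto simp: request_array_def fun_eq_iff nth_append)

lemma partial_input_snoc_Query: "partial_input (\<rho> @ [Query]) \<omega> = partial_input \<rho> \<omega>"
proof -
  have "request_array f (\<rho> @ [Query]) = request_array f \<rho>" if "f Query = 0" for f :: "request \<Rightarrow> nat"
    using that by (auto simp: request_array_def fun_eq_iff nth_append)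
  then show ?thesis by (simp add: partial_input_def)
qed

lemma wp_write_code:
  assumes "pull tag \<tau> = partial_input \<rho> \<omega>" "reg \<tau> y = length \<rho>" "reg \<tau> ''one'' = 1"
    and "\<And>\<tau>'. pull tag \<tau>' = partial_input (\<rho> @ [Update (reg \<tau> ''a'') (reg \<tau> ''b'')]) \<omega> \<Longrightarrow>
      reg \<tau>' = reg \<tau> \<Longrightarrow> same_outside (range tag) \<tau> \<tau>' \<Longrightarrow> P 3 \<tau>'"
  shows "wp W (write_code y) P \<tau>"
proof -
  define f where "f = arr \<tau> \<circ> tag"
  have f: "arr \<tau> (tag x) = f x" for x by (simp add: f_def)
  define \<tau>' where "\<tau>' = \<tau>\<lparr>arr := (arr \<tau>)
    (tag ''kind'' := (f ''kind'')(length \<rho> := 1),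
     tag ''fst'' := (f ''fst'')(length \<rho> := reg \<tau> ''a''),
     tag ''snd'' := (f ''snd'')(length \<rho> := reg \<tau> ''b''))\<rparr>"
  have 1: "f = arr (partial_input \<rho> \<omega>)" "reg \<tau> \<circ> tag = reg (partial_input \<rho> \<omega>)" "coins \<tau> = \<omega>"
    using assms(1) by (auto simp: pull_def f_def partial_input_def zero_store_def)
  have "pull tag \<tau>' = partial_input (\<rho> @ [Update (reg \<tau> ''a'') (reg \<tau> ''b'')]) \<omega>"
    unfolding pull_def \<tau>'_def
    by (simp add: f_def[symmetric] 1)
       (simp add: 1 partial_input_def request_array_snoc zero_store_def fun_upd_twist)
  moreover have "same_outside (range tag) \<tau> \<tau>'" by (auto simp: same_outside_def \<tau>'_def)
  moreover have "reg \<tau>' = reg \<tau>" by (simp add: \<tau>'_def)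
  ultimately have "P 3 \<tau>'" using assms(4) by blast
  then show ?thesis using assms(2,3) by (simp add: write_code_def \<tau>'_def f numeral_3_eq_3)
qed

text \<open>\<open>''bl''\<close> is the length of a predicted round and \<open>''rl''\<close> that
  of all rounds. \<open>''md''\<close> is the period inside a round: the two copies of the star
  start \<open>2 * n + 1\<close> positions apart.\<close>

definition pctx :: "nat \<Rightarrow> bool_mat \<Rightarrow> store \<Rightarrow> bool" where
  "pctx n M \<tau> \<longleftrightarrow> ctx n (mat_array n M) (\<lambda>_. 0) (\<lambda>_. 0) 0 \<tau> \<and>
     reg \<tau> ''md'' = 2 * n + 1 \<and> reg \<tau> ''bl'' = 4 * n + 1 \<and> reg \<tau> ''rl'' = n * (4 * n + 1)"

lemma wp_mat_code:
  assumes "ctx n (mat_array n M) u v a \<tau>" "reg \<tau> ''x'' = i" "i < n * n" "3 * n \<le> W"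
    and "P 5 (\<tau>\<lparr>reg := (reg \<tau>)(''a'' := fst (mat_edge n M i), ''c'' := of_bool (M (i div n) (i mod n)),
           ''b'' := snd (mat_edge n M i))\<rparr>)"
  shows "wp W mat_code P \<tau>"
  using assms div_mod_less_square[OF assms(3)]
  by (auto simp: mat_code_def ctx_def mat_array_def mat_edge_def eval_nat_numeral)

lemma nth_concat_replicate:
  "i < m * length xs \<Longrightarrow> concat (replicate m xs) ! i = xs ! (i mod length xs)"
proof (induction m arbitrary: i)
  case (Suc m)
  show ?case
  proof (cases "i < length xs")
    case False
    then have "(i - length xs) mod length xs = i mod length xs" by (simp add: le_mod_geq)
    then show ?thesis using Suc.IH[of "i - length xs"] Suc.prems False
      by (simp add: nth_append)
  qed (simp add: nth_append)
qed simp

lemma nth_predicted_mat: "i < n * n \<Longrightarrow> predicted n M ! i = upd (mat_edge n M i)"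
  by (simp add: predicted_def mat_edges_def nth_append)

text \<open>The second star starts at position \<open>2 * n + 1\<close>, so reducing modulo this
  number restarts the count. The round ends at position \<open>4 * n\<close>, just before the
  residue \<open>2 * n\<close> of the query would occur again.\<close>

lemma nth_predicted_round:
  assumes "j < 4 * n + 1"
  shows "predicted_round n ! j =
    (if j mod (2 * n + 1) = 2 * n then Query else upd (j mod (2 * n + 1), 3 * n))"
proof -
  consider "j < 2 * n" | "j = 2 * n" | "2 * n < j" by linarith
  then show ?thesis
  proof cases
    case 3
    then have "j mod (2 * n + 1) = j - (2 * n + 1)"
      using assms by (subst le_mod_geq) (auto intro!: mod_less)
    moreover have "j - (2 * n + 1) < 2 * n" using 3 assms by linarith
    ultimately show ?thesis using 3 assms
      by (simp add: predicted_round_def star_def nth_append nth_Cons')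
  qed (simp_all add: predicted_round_def star_def nth_append)
qed

lemma nth_predicted_rounds:
  assumes "i < n * (4 * n + 1)"
  shows "predicted n M ! (n * n + i) = (let a = i mod (4 * n + 1) mod (2 * n + 1) in
    if a = 2 * n then Query else upd (a, 3 * n))"
proof -
  have len: "length (predicted_round n) = 4 * n + 1"
    by (simp add: predicted_round_def star_def)
  have "predicted n M ! (n * n + i) = concat (replicate n (predicted_round n)) ! i"
    by (simp add: predicted_def mat_edges_def nth_append)
  also have "\<dots> = predicted_round n ! (i mod (4 * n + 1))"
    using nth_concat_replicate[of i n "predicted_round n"] assms len by simp
  also have "\<dots> = (let a = i mod (4 * n + 1) mod (2 * n + 1) in
    if a = 2 * n then Query else upd (a, 3 * n))"
    by (subst nth_predicted_round) (simp_all add: Let_def)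
  finally show ?thesis .
qed

lemma pctx_same_outside:
  assumes "same_outside (range tag) \<tau> \<tau>'" "pctx n M \<tau>" shows "pctx n M \<tau>'"
  using ctx_same_outside[OF assms(1)] assms unfolding pctx_def by (simp add: same_outside_reg)

lemma wp_fill_mat:
  assumes "pctx n M \<tau>" "pull tag \<tau> = partial_input [] \<omega>" "5 * (n * n) + 3 * n + 1 \<le> W"
  shows "wp W (for_loop ''nn'' fill_mat) (\<lambda>t \<tau>'. t \<le> 11 * (n * n) + 3 \<and> pctx n M \<tau>' \<and>
    pull tag \<tau>' = partial_input (take (n * n) (predicted n M)) \<omega>) \<tau>"
proof -
  \<comment> \<open>Eight steps per pass: five decode the entry and three write the request.\<close>
  define J where "J i t \<tau> \<longleftrightarrow> pctx n M \<tau> \<and> t \<le> 8 * i \<and>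
    pull tag \<tau> = partial_input (take i (predicted n M)) \<omega>" for i t \<tau>
  have "wp W (for_loop ''nn'' fill_mat) (\<lambda>t \<tau>. \<exists>t0. t = t0 + 3 * (n * n) + 3 \<and> J (n * n) t0 \<tau>) \<tau>"
  proof (rule wp_for_loop)
    show "J 0 0 \<tau>" using assms by (simp add: J_def)
    fix i t \<tau> assume i: "i < n * n" and J: "J i t \<tau>" and x: "reg \<tau> ''x'' = i"
    have len: "i < length (predicted n M)" using i by (simp add: length_predicted)
    have ctx: "ctx n (mat_array n M) (\<lambda>_. 0) (\<lambda>_. 0) 0 \<tau>" using J by (simp add: J_def pctx_def)
    define \<tau>1 where "\<tau>1 = \<tau>\<lparr>reg := (reg \<tau>)(''a'' := fst (mat_edge n M i),
      ''c'' := of_bool (M (i div n) (i mod n)), ''b'' := snd (mat_edge n M i))\<rparr>"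
    have \<tau>1: "pctx n M \<tau>1" "pull tag \<tau>1 = pull tag \<tau>" "reg \<tau>1 ''x'' = i" "reg \<tau>1 ''one'' = 1"
      "reg \<tau>1 ''a'' = fst (mat_edge n M i)" "reg \<tau>1 ''b'' = snd (mat_edge n M i)"
      using J x by (auto simp: \<tau>1_def pctx_def ctx_def pull_def J_def)
    have "wp W (write_code ''x'') (\<lambda>t' \<tau>'. reg \<tau>' ''x'' = i \<and> J (Suc i) (t + (5 + t')) \<tau>') \<tau>1"
    proof (rule wp_write_code)
      show "pull tag \<tau>1 = partial_input (take i (predicted n M)) \<omega>" using \<tau>1 J by (simp add: J_def)
      fix \<tau>' assume \<tau>': "pull tag \<tau>' = partial_input (take i (predicted n M) @ [Update (reg \<tau>1 ''a'') (reg \<tau>1 ''b'')]) \<omega>"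
        "reg \<tau>' = reg \<tau>1" "same_outside (range tag) \<tau>1 \<tau>'"
      have "pull tag \<tau>' = partial_input (take (Suc i) (predicted n M)) \<omega>"
        using \<tau>'(1) i len by (simp add: take_Suc_conv_app_nth nth_predicted_mat upd_def \<tau>1)
      then show "reg \<tau>' ''x'' = i \<and> J (Suc i) (t + (5 + 3)) \<tau>'"
        using pctx_same_outside[OF \<tau>'(3) \<tau>1(1)] \<tau>'(2) \<tau>1(3) J by (simp add: J_def)
    qed (use \<tau>1 len in auto)
    then show "wp W fill_mat (\<lambda>t' \<tau>'. reg \<tau>' ''x'' = i \<and> J (Suc i) (t + t') \<tau>') \<tau>"
      unfolding fill_mat_def wp_Seq[of _ mat_code] \<tau>1_def
      by (intro wp_mat_code[OF ctx x i]) (use assms(3) in auto)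
  qed (use assms in \<open>auto simp: J_def pctx_def ctx_def pull_def\<close>)
  then show ?thesis by (rule wp_mono) (auto simp: J_def)
qed

lemma wp_fill_rounds:
  assumes "pctx n M \<tau>" "pull tag \<tau> = partial_input (take (n * n) (predicted n M)) \<omega>"
    "5 * (n * n) + 3 * n + 1 \<le> W"
  shows "wp W (for_loop ''rl'' fill_rounds) (\<lambda>t \<tau>'. t \<le> 12 * (n * (4 * n + 1)) + 3 \<and> pctx n M \<tau>' \<and>
    pull tag \<tau>' = partial_input (predicted n M) \<omega>) \<tau>"
proof -
  \<comment> \<open>At most nine steps per pass: five operations, one test and three writes. A query
    leaves the arrays as they are, and extending the prefix by it changes nothing.\<close>
  define J where "J i t \<tau> \<longleftrightarrow> pctx n M \<tau> \<and> t \<le> 9 * i \<and>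
    pull tag \<tau> = partial_input (take (n * n + i) (predicted n M)) \<omega>" for i t \<tau>
  let ?m = "n * (4 * n + 1)"
  have m: "?m = 4 * (n * n) + n" by (simp add: algebra_simps)
  have "wp W (for_loop ''rl'' fill_rounds) (\<lambda>t \<tau>. \<exists>t0. t = t0 + 3 * ?m + 3 \<and> J ?m t0 \<tau>) \<tau>"
  proof (rule wp_for_loop)
    show "J 0 0 \<tau>" using assms by (simp add: J_def)
    show "?m \<le> W" "1 \<le> W" unfolding m using assms(3) by auto
    fix i t \<tau> assume i: "i < ?m" and J: "J i t \<tau>" and x: "reg \<tau> ''x'' = i"
    define a where "a = i mod (4 * n + 1) mod (2 * n + 1)"
    have len: "n * n + i < length (predicted n M)" using i by (simp add: length_predicted)
    have nth: "predicted n M ! (n * n + i) = (if a = 2 * n then Query else upd (a, 3 * n))"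
      using nth_predicted_rounds[OF i] by (simp add: a_def Let_def)
    have snoc: "take (n * n + Suc i) (predicted n M) =
        take (n * n + i) (predicted n M) @ [predicted n M ! (n * n + i)]"
      using len by (simp add: take_Suc_conv_app_nth)
    define \<tau>1 where "\<tau>1 = \<tau>\<lparr>reg := (reg \<tau>)(''a'' := a, ''b'' := 3 * n, ''y'' := n * n + i,
      ''c'' := of_bool (a = 2 * n))\<rparr>"
    have \<tau>1: "pctx n M \<tau>1" "pull tag \<tau>1 = partial_input (take (n * n + i) (predicted n M)) \<omega>"
      "reg \<tau>1 ''x'' = i" "reg \<tau>1 ''one'' = 1"
      "reg \<tau>1 ''a'' = a" "reg \<tau>1 ''b'' = 3 * n" "reg \<tau>1 ''y'' = n * n + i" "reg \<tau>1 ''c'' = of_bool (a = 2 * n)"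
      using J x by (auto simp: \<tau>1_def pctx_def ctx_def pull_def J_def)
    have main: "wp W (If ''c'' Skip (write_code ''y'')) (\<lambda>t' \<tau>'. reg \<tau>' ''x'' = i \<and> J (Suc i) (t + (1 + (1 + (1 + (1 + (1 + t')))))) \<tau>') \<tau>1"
    proof (cases "a = 2 * n")
      case True
      then have "pull tag \<tau>1 = partial_input (take (n * n + Suc i) (predicted n M)) \<omega>"
        unfolding snoc nth by (simp add: partial_input_snoc_Query \<tau>1(2))
      then show ?thesis using \<tau>1 True J by (simp add: J_def)
    next
      case False
      have "wp W (write_code ''y'') (\<lambda>t' \<tau>'. reg \<tau>' ''x'' = i \<and> J (Suc i) (t + (1 + (1 + (1 + (1 + (1 + (1 + t'))))))) \<tau>') \<tau>1"
      proof (rule wp_write_code[OF \<tau>1(2)])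
        fix \<tau>' assume \<tau>': "pull tag \<tau>' = partial_input (take (n * n + i) (predicted n M) @ [Update (reg \<tau>1 ''a'') (reg \<tau>1 ''b'')]) \<omega>"
          "reg \<tau>' = reg \<tau>1" "same_outside (range tag) \<tau>1 \<tau>'"
        have "pull tag \<tau>' = partial_input (take (n * n + Suc i) (predicted n M)) \<omega>"
          unfolding snoc nth using \<tau>'(1) False by (simp add: upd_def \<tau>1)
        then show "reg \<tau>' ''x'' = i \<and> J (Suc i) (t + (1 + (1 + (1 + (1 + (1 + (1 + 3))))))) \<tau>'"
          using pctx_same_outside[OF \<tau>'(3) \<tau>1(1)] \<tau>'(2) \<tau>1(3) J by (simp add: J_def)
      qed (use \<tau>1 len in auto)
      then show ?thesis using False \<tau>1 by simp
    qed
    have le: "i mod (4 * n + 1) \<le> W" "a \<le> W" "n * n + i \<le> W"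
    proof -
      show "n * n + i \<le> W" using i assms(3) unfolding m by simp
      have "a \<le> i" "i mod (4 * n + 1) \<le> i" unfolding a_def by (meson mod_less_eq_dividend order_trans)+
      with \<open>n * n + i \<le> W\<close> show "i mod (4 * n + 1) \<le> W" "a \<le> W" by linarith+
    qed
    have "reg \<tau> ''src'' = 3 * n" "reg \<tau> ''nil'' = 0" "reg \<tau> ''nn'' = n * n" "reg \<tau> ''dn'' = 2 * n"
      "reg \<tau> ''md'' = 2 * n + 1" "reg \<tau> ''bl'' = 4 * n + 1"
      using J by (auto simp: J_def pctx_def ctx_def)
    then show "wp W fill_rounds (\<lambda>t' \<tau>'. reg \<tau>' ''x'' = i \<and> J (Suc i) (t + t') \<tau>') \<tau>"
      unfolding fill_rounds_def wp_Seq wp_Bin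
      using main le assms(3) x by (simp del: wp_If add: \<tau>1_def a_def)
  qed (auto simp: J_def pctx_def ctx_def pull_def)
  then show ?thesis
    by (rule wp_mono) (auto simp: J_def length_predicted)
qed

lemma wp_insert_mat:
  assumes "ctx n (mat_array n M) u v a \<tau>"
    and "updates A W (pull tag \<tau>) (mat_edges n M) t \<sigma>" and W: "W \<le> W'" "5 * (n * n) + 3 * n + 1 \<le> W'"
  shows "wp W' (for_loop ''nn'' (Seq mat_code (update_call A ''a'' ''b''))) (\<lambda>t' \<tau>'.
    t' \<le> t + 10 * (n * n) + 3 \<and> ctx n (mat_array n M) u v a \<tau>' \<and> pull tag \<tau>' = \<sigma>) \<tau>"
proof -
  let ?ctx = "ctx n (mat_array n M) u v a"
  have edges: "mat_edges n M = concat (map (\<lambda>i. [mat_edge n M i]) [0..<n * n])"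
    by (simp add: mat_edges_def concat_map_singleton)
  \<comment> \<open>Five steps decode the entry and two copy its endpoints for the simulated update;
    the counter adds three.\<close>
  have "wp W' (for_loop ''nn'' (Seq mat_code (update_call A ''a'' ''b''))) (\<lambda>t' \<tau>'.
    t' \<le> t + (7 + 3) * (n * n) + 3 \<and> ?ctx \<tau>' \<and> pull tag \<tau>' = \<sigma>) \<tau>"
  proof (rule wp_for_loop_updates[OF _ assms(1) assms(2)[unfolded edges]])
    fix i \<tau> t \<sigma>1
    assume i: "i < n * n" "?ctx \<tau>" "reg \<tau> ''x'' = i" "updates A W (pull tag \<tau>) [mat_edge n M i] t \<sigma>1"
    define \<tau>1 where "\<tau>1 = \<tau>\<lparr>reg := (reg \<tau>)(''a'' := fst (mat_edge n M i),
      ''c'' := of_bool (M (i div n) (i mod n)), ''b'' := snd (mat_edge n M i))\<rparr>"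
    have \<tau>1: "?ctx \<tau>1" "pull tag \<tau>1 = pull tag \<tau>" "reg \<tau>1 ''x'' = i" "reg \<tau>1 ''nil'' = 0"
      "reg \<tau>1 ''a'' = fst (mat_edge n M i)" "reg \<tau>1 ''b'' = snd (mat_edge n M i)"
      using i by (auto simp: \<tau>1_def ctx_def pull_def)
    have le: "fst (mat_edge n M i) \<le> W'" "snd (mat_edge n M i) \<le> W'"
      using div_mod_less_square[OF i(1)] W by (auto simp: mat_edge_def)
    have "wp W' (update_call A ''a'' ''b'') (\<lambda>t' \<tau>'. 5 + t' \<le> t + 7 \<and> ?ctx \<tau>' \<and>
        reg \<tau>' ''x'' = i \<and> pull tag \<tau>' = \<sigma>1) \<tau>1"
      by (rule wp_update_call[OF _ W(1), of A _ _ _ t \<sigma>1])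
         (use i \<tau>1 le in \<open>auto simp: same_outside_reg intro: ctx_same_outside\<close>)
    then show "wp W' (Seq mat_code (update_call A ''a'' ''b''))
      (\<lambda>t' \<tau>'. t' \<le> t + 7 \<and> ?ctx \<tau>' \<and> reg \<tau>' ''x'' = i \<and> pull tag \<tau>' = \<sigma>1) \<tau>"
      unfolding wp_Seq[of _ mat_code] \<tau>1_def
      by (intro wp_mat_code[OF i(2,3,1)]) (use W in auto)
  qed (use W in \<open>auto simp: ctx_def\<close>)
  then show ?thesis by simp
qed

text \<open>The quadratic coefficient is \<open>11 + 48 + 10\<close>: writing the matrix part,
  writing the \<open>n * (4 * n + 1)\<close> requests of the rounds at 12 steps each, and inserting
  the matrix. The rounds also give \<open>12 * n\<close>. The constant 19 consists of 7 and 3 for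
  setting registers and 3 for each of the three loops.\<close>

lemma prep_prog_simulates:
  assumes exec: "exec W (dyn_prep A) (dyn_init (3 * n + 1) (3 * n) (predicted n M) \<omega>) p \<sigma>"
    and upds: "updates A W \<sigma> (mat_edges n M) t \<sigma>'"
    and W: "W \<le> W'" "5 * (n * n) + 4 * n + 1 \<le> W'"
  shows "\<exists>t' \<tau>'. exec W' (prep_prog A) (oumv_init n M \<omega>) t' \<tau>' \<and> t' \<le> p + t + 69 * (n * n) + 12 * n + 19 \<and>
    pull tag \<tau>' = \<sigma>' \<and> ctx n (mat_array n M) (\<lambda>_. 0) (\<lambda>_. 0) 0 \<tau>'"
proof -
  let ?Q = "\<lambda>t' \<tau>'. t' \<le> p + t + 69 * (n * n) + 12 * n + 19 \<and> pull tag \<tau>' = \<sigma>' \<and>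
    ctx n (mat_array n M) (\<lambda>_. 0) (\<lambda>_. 0) 0 \<tau>'"
  have W3: "5 * (n * n) + 3 * n + 1 \<le> W'" using W by simp
  have m: "n * (4 * n + 1) = 4 * (n * n) + n" by (simp add: algebra_simps)
  have init: "wp W' setup_regs (\<lambda>t \<tau>. t = 7 \<and> pctx n M \<tau> \<and> pull tag \<tau> = partial_input [] \<omega>) (oumv_init n M \<omega>)"
  proof -
    have "request_array f [] = (\<lambda>_. 0)" for f by (simp add: request_array_def)
    moreover have "(\<lambda>_. c) \<circ> tag = (\<lambda>_. c)" for c by auto
    moreover have "n * Suc (4 * n) \<le> W'" using W3 m by simp
    moreover have "(\<lambda>_ (_ :: nat). 0 :: nat)(x := \<lambda>_. 0) = (\<lambda>_ _. 0)" for x :: name by auto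
    ultimately show ?thesis using W(2)
      by (simp add: setup_regs_def oumv_init_def pctx_def ctx_def pull_def partial_input_def zero_store_def
          eval_nat_numeral add.assoc)
  qed
  have inp: "wp W' setup_input (\<lambda>t \<tau>'. t = 3 \<and> pctx n M \<tau>' \<and>
      pull tag \<tau>' = dyn_init (3 * n + 1) (3 * n) (predicted n M) \<omega>) \<tau>"
    if "pctx n M \<tau>" "pull tag \<tau> = partial_input (predicted n M) \<omega>" for \<tau>
  proof -
    have 1: "arr \<tau> \<circ> tag = arr (partial_input (predicted n M) \<omega>)"
      "reg \<tau> \<circ> tag = reg (partial_input (predicted n M) \<omega>)" "coins \<tau> = \<omega>"
      using that(2) by (auto simp: pull_def partial_input_def zero_store_def)
    have "n * n + n * Suc (4 * n) \<le> W'" using W3 m by simp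
    then show ?thesis using that(1) W3
      by (simp add: setup_input_def pctx_def ctx_def pull_def 1)
         (simp add: partial_input_def dyn_init_def zero_store_def length_predicted)
  qed
  have "wp W' (prep_prog A) ?Q (oumv_init n M \<omega>)"
    unfolding prep_prog_def wp_Seq[of _ setup_regs] wp_Seq[of _ "for_loop _ _"]
      wp_Seq[of _ setup_input] wp_Seq[of _ "rename _ _"]
  proof (rule wp_mono[OF init], elim conjE)
    fix t1 :: nat and \<tau>1 assume 1: "t1 = 7" "pctx n M \<tau>1" "pull tag \<tau>1 = partial_input [] \<omega>"
    show "wp W' (for_loop ''nn'' fill_mat) (\<lambda>t2. wp W' (for_loop ''rl'' fill_rounds) (\<lambda>t3.
      wp W' setup_input (\<lambda>t4. wp W' (rename tag (dyn_prep A)) (\<lambda>t5.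
        wp W' (for_loop ''nn'' (Seq mat_code (update_call A ''a'' ''b'')))
         (\<lambda>t6. ?Q (t1 + (t2 + (t3 + (t4 + (t5 + t6))))))))) ) \<tau>1"
    proof (rule wp_mono[OF wp_fill_mat[OF 1(2,3) W3]], elim conjE)
      fix t2 \<tau>2 assume 2: "t2 \<le> 11 * (n * n) + 3" "pctx n M \<tau>2"
        "pull tag \<tau>2 = partial_input (take (n * n) (predicted n M)) \<omega>"
      show "wp W' (for_loop ''rl'' fill_rounds) (\<lambda>t3.
        wp W' setup_input (\<lambda>t4. wp W' (rename tag (dyn_prep A)) (\<lambda>t5.
          wp W' (for_loop ''nn'' (Seq mat_code (update_call A ''a'' ''b'')))
           (\<lambda>t6. ?Q (t1 + (t2 + (t3 + (t4 + (t5 + t6))))))))) \<tau>2"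
      proof (rule wp_mono[OF wp_fill_rounds[OF 2(2,3) W3]], elim conjE)
        fix t3 \<tau>3 assume 3: "t3 \<le> 12 * (n * (4 * n + 1)) + 3" "pctx n M \<tau>3"
          "pull tag \<tau>3 = partial_input (predicted n M) \<omega>"
        show "wp W' setup_input (\<lambda>t4. wp W' (rename tag (dyn_prep A)) (\<lambda>t5.
          wp W' (for_loop ''nn'' (Seq mat_code (update_call A ''a'' ''b'')))
           (\<lambda>t6. ?Q (t1 + (t2 + (t3 + (t4 + (t5 + t6)))))))) \<tau>3"
        proof (rule wp_mono[OF inp[OF 3(2,3)]], elim conjE)
          fix t4 :: nat and \<tau>4 assume 4: "t4 = 3" "pctx n M \<tau>4"
            "pull tag \<tau>4 = dyn_init (3 * n + 1) (3 * n) (predicted n M) \<omega>"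
          show "wp W' (rename tag (dyn_prep A)) (\<lambda>t5.
            wp W' (for_loop ''nn'' (Seq mat_code (update_call A ''a'' ''b'')))
             (\<lambda>t6. ?Q (t1 + (t2 + (t3 + (t4 + (t5 + t6))))))) \<tau>4"
          proof (rule wp_rename[OF _ W(1)])
            show "exec W (dyn_prep A) (pull tag \<tau>4) p \<sigma>" using exec 4 by simp
            fix \<tau>5 assume 5: "pull tag \<tau>5 = \<sigma>" "same_outside (range tag) \<tau>4 \<tau>5"
            have ctx: "ctx n (mat_array n M) (\<lambda>_. 0) (\<lambda>_. 0) 0 \<tau>5"
              using pctx_same_outside[OF 5(2) 4(2)] by (simp add: pctx_def)
            show "wp W' (for_loop ''nn'' (Seq mat_code (update_call A ''a'' ''b'')))
             (\<lambda>t6. ?Q (t1 + (t2 + (t3 + (t4 + (p + t6)))))) \<tau>5"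
              by (rule wp_mono[OF wp_insert_mat[OF ctx _ W(1) W3, of A t \<sigma>']])
                 (use upds 5(1) 1(1) 2(1) 3(1)[unfolded m] 4(1) in auto)
          qed
        qed
      qed
    qed
  qed
  then show ?thesis unfolding wp_def by blast
qed

section \<open>The reduction as a whole\<close>

definition reduction :: "dyn_alg \<Rightarrow> oumv_alg" where
  "reduction A = \<lparr>oumv_prep = prep_prog A, oumv_round = round_prog A\<rparr>"

text \<open>The times \<open>ts1\<close> of the requests that insert the matrix are charged to the
  preprocessing, so only \<open>ts2\<close> enters the online time. The coin stream is the same on
  both sides.\<close>

lemma reduction_simulates:
  assumes run: "dyn_run A W (3 * n + 1) (3 * n) (predicted n M) (requests n M uvs) \<omega> p ts as"
    and W: "W \<le> W'" "5 * (n * n) + 4 * n + 1 \<le> W'"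
  shows "\<exists>p' t ts1 ts2. oumv_run (reduction A) W' n M uvs \<omega> p' t (map (\<lambda>a. of_bool (0 < a)) as) \<and>
    ts = ts1 @ ts2 \<and> length ts1 = n * n \<and> length ts = length (requests n M uvs) \<and>
    p' \<le> p + sum_list ts1 + 69 * (n * n) + 12 * n + 19 \<and>
    t \<le> sum_list ts2 + length uvs * (38 * n + 10)"
proof -
  from run obtain \<sigma> where \<sigma>: "exec W (dyn_prep A) (dyn_init (3 * n + 1) (3 * n) (predicted n M) \<omega>) p \<sigma>"
    "dyn_serve A W \<sigma> (requests n M uvs) ts as" by (auto simp: dyn_run_def)
  have len: "length ts = length (requests n M uvs)"
    using \<sigma>(2) by (induction rule: dyn_serve.induct) auto
  from dyn_serve_updates[OF \<sigma>(2)[unfolded requests_def]] obtain ts1 ts2 \<sigma>' where 1: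
    "ts = ts1 @ ts2" "length ts1 = length (mat_edges n M)"
    "updates A W \<sigma> (mat_edges n M) (sum_list ts1) \<sigma>'"
    "dyn_serve A W \<sigma>' (concat (map (\<lambda>(u, v). round_requests n u v) uvs)) ts2 as" by blast
  from prep_prog_simulates[OF \<sigma>(1) 1(3) W] obtain p' \<tau> where 2:
    "exec W' (prep_prog A) (oumv_init n M \<omega>) p' \<tau>" "p' \<le> p + sum_list ts1 + 69 * (n * n) + 12 * n + 19"
    "pull tag \<tau> = \<sigma>'" "ctx n (mat_array n M) (\<lambda>_. 0) (\<lambda>_. 0) 0 \<tau>" by blast
  have "3 * n + 1 \<le> W'" using W(2) by simp
  from rounds_simulate[OF 2(4) _ W(1) this, of A uvs ts2 as "reduction A"] 1(4) 2(3)
  obtain t where "oumv_rounds (reduction A) W' n \<tau> uvs t (map (\<lambda>a. of_bool (0 < a)) as)"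
    "t \<le> sum_list ts2 + length uvs * (38 * n + 10)" by (auto simp: reduction_def)
  then have "oumv_run (reduction A) W' n M uvs \<omega> p' t (map (\<lambda>a. of_bool (0 < a)) as)"
    using 2(1) by (auto simp: oumv_run_def reduction_def)
  with 1(1,2) 2(2) len show ?thesis
    using \<open>t \<le> _\<close> by (intro exI[of _ p'] exI[of _ t] exI[of _ ts1] exI[of _ ts2]) (simp add: mat_edges_def)
qed

subsection \<open>Running times\<close>

lemma sum_list_le_sum_list_map:
  assumes "list_all2 (\<lambda>t r. real t \<le> g r) ts \<rho>"
  shows "real (sum_list ts) \<le> sum_list (map g \<rho>)"
  using assms by induction auto

lemma sum_list_request_time_upd: "sum_list (map (request_time U Q) (map upd es)) = real (length es) * U"
  by (induction es) (auto simp: request_time_def upd_def algebra_simps)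

lemma sum_list_request_time_rounds:
  "sum_list (map (request_time U Q) (concat (map (\<lambda>(u, v). round_requests n u v) uvs))) =
   real (length uvs) * (real (4 * n) * U + Q)"
proof -
  have "sum_list (map (request_time U Q) (round_requests n u v)) = real (4 * n) * U + Q" for u v
  proof -
    have "sum_list (map (request_time U Q) (round_requests n u v)) =
      real (length (sel n True u v)) * U + (Q + (real (length (sel n False u v)) * U + real (length (star n)) * U))"
      unfolding round_requests_def map_append list.map(2) sum_list.Cons sum_list_append
        sum_list_request_time_upd
      by (simp add: request_time_def)
    also have "\<dots> = real (length (sel n True u v) + length (sel n False u v) + length (star n)) * U + Q"
      by (simp add: algebra_simps)
    also have "\<dots> = real (4 * n) * U + Q"
      by (simp add: length_sel star_def)
    finally show ?thesis .
  qed
  then show ?thesis by (induction uvs) (auto simp: algebra_simps)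
qed

text \<open>\<open>U\<close> and \<open>Q\<close> are arbitrary real functions, but they bound the
  times of actual runs: a sequence of a single request, predicted exactly, forces them to be
  nonnegative. An update needs two vertices, whence \<open>n \<ge> 2\<close>.\<close>

lemma solves_s_triangle_delayed_nonneg:
  assumes "solves_s_triangle_delayed A d U Q" "n \<ge> 2"
  shows "U n \<ge> 0" "Q n \<ge> 0"
proof -
  have "request_time (U n) (Q n) r \<ge> 0" if r: "valid_request n r" for r
  proof -
    have "delayed_for (d n) [r] {[r]}" by (rule delayed_for_refl)
    with assms(1) obtain ts where "real (ts ! 0) \<le> request_time (U n) (Q n) r"
      unfolding solves_s_triangle_delayed_def Let_def using assms(2) r
      by (elim exE) (drule spec[of _ n], drule spec[of _ 0], drule spec[of _ "[r]"],
        drule spec[of _ "[r]"], auto)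
    then show ?thesis by (meson of_nat_0_le_iff order_trans)
  qed
  from this[of "Update 0 1"] this[of Query] show "U n \<ge> 0" "Q n \<ge> 0"
    using assms(2) by (auto simp: valid_request_def request_time_def)
qed

text \<open>The preprocessing has to meet its bound at every size, and the bound is a pure power of
  \<open>n + 2\<close>. So the finitely many small sizes and the constant factor both have to be
  absorbed into the exponent.\<close>

lemma update_time_polynomially_bounded:
  assumes "strictly_below_power (\<lambda>n. real n ^ 2 * U n + real n * Q n) 3"
    and nonneg: "\<And>n. n \<ge> 2 \<Longrightarrow> U n \<ge> 0" "\<And>n. n \<ge> 2 \<Longrightarrow> Q n \<ge> 0"
  shows "\<exists>K. \<forall>n\<ge>1. real (n * n) * U (3 * n + 1) \<le> real ((n + 2) ^ K)"
proof -
  from assms(1) obtain C \<epsilon> n0 where C: "C > 0" "\<epsilon> > 0"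
    "\<And>n. n \<ge> n0 \<Longrightarrow> real n ^ 2 * U n + real n * Q n \<le> C * real n powr (3 - \<epsilon>)"
    unfolding strictly_below_power_def eventually_sequentially by blast
  define f where "f n = real (n * n) * U (3 * n + 1)" for n
  \<comment> \<open>A single constant that dominates the values at all sizes below
    \<open>n0\<close>, about which the asymptotic hypothesis says nothing.\<close>
  define S where "S = (\<Sum>n<n0. \<bar>f n\<bar>)"
  obtain K0 :: nat where K0: "C + S \<le> real K0" using real_arch_simple by blast
  have S: "S \<ge> 0" by (simp add: S_def sum_nonneg)
  have "f n \<le> real ((n + 2) ^ (K0 + 6))" if n: "n \<ge> 1" for n
  proof -
    have "f n \<le> (C + S) * real ((n + 2) ^ 6)"
    proof (cases "n < n0")
      case True
      have "f n \<le> \<bar>f n\<bar>" by simp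
      also have "\<bar>f n\<bar> \<le> S" unfolding S_def using True by (intro member_le_sum) auto
      also have "S \<le> (C + S) * 1" using C by simp
      also have "\<dots> \<le> (C + S) * real ((n + 2) ^ 6)"
        using C S by (intro mult_left_mono) (auto simp del: power_Suc)
      finally show ?thesis .
    next
      case False
      define N where "N = 3 * n + 1"
      have N: "N \<ge> n0" "N \<ge> 2" using False n by (auto simp: N_def)
      have "f n \<le> real N ^ 2 * U N"
        unfolding f_def N_def[symmetric] power2_eq_square of_nat_mult
        by (intro mult_right_mono mult_mono nonneg N) (auto simp: N_def)
      also have "\<dots> \<le> real N ^ 2 * U N + real N * Q N" using nonneg(2)[OF N(2)] by simp
      also have "\<dots> \<le> C * real N powr (3 - \<epsilon>)" using C(3)[OF N(1)] .
      also have "\<dots> \<le> C * real N powr 3"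
        using C N by (intro mult_left_mono powr_mono) auto
      also have "\<dots> = C * real (N ^ 3)" using N by simp
      \<comment> \<open>Here \<open>3 * n + 1\<close> is bounded by the square of
        \<open>n + 2\<close>, which is where the exponent 6 comes from.\<close>
      also have "\<dots> \<le> C * real (((n + 2) ^ 2) ^ 3)"
        using C by (intro mult_left_mono) (simp_all only: of_nat_le_iff, intro power_mono, auto simp: N_def power2_eq_square)
      also have "\<dots> \<le> (C + S) * real ((n + 2) ^ 6)"
        using S C(1) by (intro mult_mono) (auto simp: power_mult[symmetric] simp del: of_nat_power)
      finally show ?thesis .
    qed
    also have "\<dots> \<le> real K0 * real ((n + 2) ^ 6)" using K0 by (intro mult_right_mono) auto
    \<comment> \<open>The constant moves into the exponent by \<open>K0 \<le> 2 ^ K0\<close>, the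
      base being at least 2.\<close>
    also have "\<dots> \<le> real ((n + 2) ^ K0) * real ((n + 2) ^ 6)"
    proof (intro mult_right_mono)
      have "K0 \<le> 2 ^ K0" by (simp add: less_imp_le)
      also have "\<dots> \<le> (n + 2) ^ K0" by (intro power_mono) auto
      finally show "real K0 \<le> real ((n + 2) ^ K0)" by (simp only: of_nat_le_iff)
    qed simp
    finally show ?thesis by (simp add: power_add)
  qed
  then show ?thesis unfolding f_def by blast
qed

lemma reduction_time_bigo:
  assumes "strictly_below_power (\<lambda>n. real n ^ 2 * U n + real n * Q n) 3"
    and nonneg: "\<And>n. n \<ge> 2 \<Longrightarrow> U n \<ge> 0" "\<And>n. n \<ge> 2 \<Longrightarrow> Q n \<ge> 0"
  shows "\<exists>\<epsilon>>0. (\<lambda>n. real n * (38 * real n + 10) +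
    real n * (real (4 * n) * U (3 * n + 1) + Q (3 * n + 1))) \<in> O(\<lambda>n. real n powr (3 - \<epsilon>))"
proof -
  from assms(1) obtain C \<epsilon>0 n0 where C: "C > 0" "\<epsilon>0 > 0"
    "\<And>n. n \<ge> n0 \<Longrightarrow> real n ^ 2 * U n + real n * Q n \<le> C * real n powr (3 - \<epsilon>0)"
    unfolding strictly_below_power_def eventually_sequentially by blast
  \<comment> \<open>The reduction spends quadratic time of its own, so the saving is capped at 1 to
    keep \<open>3 - \<epsilon>\<close> at least 2.\<close>
  define \<epsilon> where "\<epsilon> = min \<epsilon>0 1"
  have \<epsilon>: "\<epsilon> > 0" "\<epsilon> \<le> 1" "\<epsilon> \<le> \<epsilon>0" using C by (auto simp: \<epsilon>_def)
  define T where "T n = real n * (38 * real n + 10) +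
    real n * (real (4 * n) * U (3 * n + 1) + Q (3 * n + 1))" for n
  have "T \<in> O(\<lambda>n. real n powr (3 - \<epsilon>))"
  proof (rule bigoI)
    show "\<forall>\<^sub>F n in sequentially. norm (T n) \<le> (48 + C * 4 powr (3 - \<epsilon>)) * norm (real n powr (3 - \<epsilon>))"
      unfolding eventually_sequentially
    proof (intro exI[of _ "max n0 1"] allI impI)
      fix n assume n: "max n0 1 \<le> n"
      define N where "N = 3 * n + 1"
      have N: "N \<ge> n0" "N \<ge> 2" "N \<le> 4 * n" using n by (auto simp: N_def)
      note pos = nonneg[OF N(2)]
      have "T n \<ge> 0" unfolding T_def N_def[symmetric] using pos by simp
      have "real n * (38 * real n + 10) \<le> 48 * real n powr 2"
        using n by (simp add: power2_eq_square algebra_simps)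
      also have "\<dots> \<le> 48 * real n powr (3 - \<epsilon>)"
        using n \<epsilon> by (intro mult_left_mono powr_mono) auto
      finally have 1: "real n * (38 * real n + 10) \<le> 48 * real n powr (3 - \<epsilon>)" .
      have "real n * real (4 * n) * U N \<le> real N ^ 2 * U N"
      proof (intro mult_right_mono pos)
        have "n * (4 * n) \<le> N ^ 2" by (simp add: N_def power2_eq_square algebra_simps)
        then show "real n * real (4 * n) \<le> real N ^ 2"
          by (simp only: of_nat_mult[symmetric] of_nat_power[symmetric] of_nat_le_iff)
      qed
      moreover have "real n * Q N \<le> real N * Q N"
        by (intro mult_right_mono pos) (simp add: N_def)
      ultimately have "real n * (real (4 * n) * U N + Q N) \<le> real N ^ 2 * U N + real N * Q N"
        by (simp add: algebra_simps)
      also have "\<dots> \<le> C * real N powr (3 - \<epsilon>0)" using C(3)[OF N(1)] .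
      also have "\<dots> \<le> C * real N powr (3 - \<epsilon>)"
        using C N \<epsilon> by (intro mult_left_mono powr_mono) auto
      \<comment> \<open>Passing from the simulated size back to \<open>n\<close> costs the factor 4
        in the base, as \<open>N \<le> 4 * n\<close>; the cap on \<open>\<epsilon>\<close> makes the
        exponent positive.\<close>
      also have "\<dots> \<le> C * real (4 * n) powr (3 - \<epsilon>)"
        using C N \<epsilon> by (intro mult_left_mono powr_mono2) (auto simp del: of_nat_mult)
      also have "\<dots> = C * 4 powr (3 - \<epsilon>) * real n powr (3 - \<epsilon>)"
        by (simp add: powr_mult)
      finally have "T n \<le> (48 + C * 4 powr (3 - \<epsilon>)) * real n powr (3 - \<epsilon>)"
        using 1 unfolding T_def N_def[symmetric] by (simp add: algebra_simps)
      with \<open>T n \<ge> 0\<close> show "norm (T n) \<le> (48 + C * 4 powr (3 - \<epsilon>)) * norm (real n powr (3 - \<epsilon>))" by simp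
    qed
  qed
  with \<epsilon>(1) show ?thesis unfolding T_def by blast
qed

text \<open>\<open>m\<close> is the input size of the simulated algorithm, at most the cube of
  \<open>b = n + 2\<close>. Since \<open>69 \<le> 3 ^ 4\<close> and \<open>b \<ge> 3\<close>, the
  overhead is at most \<open>b ^ 6\<close>. Each of the three summands is thus at most
  \<open>b ^ (3 * k + K + 6)\<close>, and the factor 3 is absorbed by one more power of
  \<open>b\<close>.\<close>

lemma power_bounds:
  fixes n k K :: nat
  assumes "n \<ge> 1"
  defines "w \<equiv> (n + 2) ^ (3 * k + K + 7)" and "m \<equiv> 3 * n + 1 + (n * n + n * (4 * n + 1)) + 2"
  shows "m ^ k \<le> w" "5 * (n * n) + 4 * n + 1 \<le> w"
    "m ^ k + (n + 2) ^ K + (69 * (n * n) + 12 * n + 19) \<le> w"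
proof -
  define b where "b = n + 2"
  have b: "b \<ge> 3" using assms(1) by (simp add: b_def)
  have "m \<le> b ^ 3" by (simp add: m_def b_def power3_eq_cube algebra_simps)
  have mono: "b ^ i \<le> b ^ j" if "i \<le> j" for i j using b that by (intro power_increasing) auto
  have mk: "m ^ k \<le> b ^ (3 * k)" using power_mono[OF \<open>m \<le> b ^ 3\<close>] by (simp add: power_mult)
  have "69 * (n * n) + 12 * n + 19 \<le> 69 * b ^ 2" by (simp add: b_def power2_eq_square algebra_simps)
  also have "\<dots> \<le> 3 ^ 4 * b ^ 2" by simp
  also have "\<dots> \<le> b ^ 4 * b ^ 2" using b by (intro mult_right_mono power_mono) auto
  also have "\<dots> = b ^ 6" by (simp add: power_add[symmetric])
  finally have c: "69 * (n * n) + 12 * n + 19 \<le> b ^ 6" .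
  have "m ^ k + b ^ K + (69 * (n * n) + 12 * n + 19) \<le> 3 * b ^ (3 * k + K + 6)"
    using mk c mono[of "3 * k" "3 * k + K + 6"] mono[of K "3 * k + K + 6"] mono[of 6 "3 * k + K + 6"]
    by linarith
  also have "\<dots> \<le> b * b ^ (3 * k + K + 6)" using b by (intro mult_right_mono) auto
  also have "\<dots> = b ^ Suc (3 * k + K + 6)" by (rule power_Suc[symmetric])
  also have "Suc (3 * k + K + 6) = 3 * k + K + 7" by simp
  also have "b ^ (3 * k + K + 7) = w" by (simp only: w_def b_def)
  finally show 1: "m ^ k + (n + 2) ^ K + (69 * (n * n) + 12 * n + 19) \<le> w" by (simp add: b_def)
  show "m ^ k \<le> w" "5 * (n * n) + 4 * n + 1 \<le> w" using 1 by linarith+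
qed

lemma reduction_solves_oumv:
  assumes solves: "solves_s_triangle_delayed A d U Q" and d: "\<And>n. d n = 2 * n"
    and below: "strictly_below_power (\<lambda>n. real n ^ 2 * U n + real n * Q n) 3"
  shows "solves_oumv (reduction A) (\<lambda>n. real n * (38 * real n + 10) +
    real n * (real (4 * n) * U (3 * n + 1) + Q (3 * n + 1)))" (is "solves_oumv _ ?T")
proof -
  obtain k where "\<forall>n s \<rho>' \<rho>. s < n \<longrightarrow> (\<forall>r\<in>set \<rho>'. valid_request n r) \<longrightarrow>
      delayed_for (d n) \<rho>' {\<rho>} \<longrightarrow>
      (\<forall>\<omega>. \<exists>p ts as. dyn_run A ((n + length \<rho>' + 2) ^ k) n s \<rho>' \<rho> \<omega> p ts as \<and>
         p \<le> (n + length \<rho>' + 2) ^ k \<and>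
         (\<forall>i<length \<rho>. real (ts ! i) \<le> request_time (U n) (Q n) (\<rho> ! i))) \<and>
      measure fair_coins {\<omega>. \<exists>p ts.
        dyn_run A ((n + length \<rho>' + 2) ^ k) n s \<rho>' \<rho> \<omega> p ts (correct_answers n s {} \<rho>)} \<ge> 2 / 3"
    using solves unfolding solves_s_triangle_delayed_def Let_def by (elim exE) (rule that)
  note k = this[THEN spec, THEN spec, THEN spec, THEN spec, THEN mp, THEN mp, THEN mp]
  obtain K where K: "\<And>n. n \<ge> 1 \<Longrightarrow> real (n * n) * U (3 * n + 1) \<le> real ((n + 2) ^ K)"
    using update_time_polynomially_bounded[OF below] solves_s_triangle_delayed_nonneg[OF solves] by blast
  show ?thesis unfolding solves_oumv_def
  proof (intro exI[of _ "3 * k + K + 7"] allI impI)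
    fix n :: nat and M and uvs :: "(bool_vec \<times> bool_vec) list"
    assume n: "n \<ge> 1" and len: "length uvs = n"
    define W' where "W' = (n + 2) ^ (3 * k + K + 7)"
    define m where "m = 3 * n + 1 + length (predicted n M) + 2"
    define \<rho> where "\<rho> = requests n M uvs"
    let ?N = "3 * n + 1"
    have W: "m ^ k \<le> W'" "5 * (n * n) + 4 * n + 1 \<le> W'"
      "m ^ k + (n + 2) ^ K + (69 * (n * n) + 12 * n + 19) \<le> W'"
      using power_bounds[OF n, of k K] unfolding W'_def m_def length_predicted by auto
    have dyn: "\<And>\<omega>. \<exists>p ts as. dyn_run A (m ^ k) ?N (3 * n) (predicted n M) \<rho> \<omega> p ts as \<and> p \<le> m ^ k \<and>
                 (\<forall>i<length \<rho>. real (ts ! i) \<le> request_time (U ?N) (Q ?N) (\<rho> ! i))"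
      and prob: "measure fair_coins {\<omega>. \<exists>p ts. dyn_run A (m ^ k) ?N (3 * n) (predicted n M) \<rho> \<omega> p ts
            (correct_answers ?N (3 * n) {} \<rho>)} \<ge> 2 / 3"
      using k[of "3 * n" ?N "predicted n M" \<rho>] valid_predicted
        predicted_delayed_for_requests[OF len, of "d ?N" M]
      by (auto simp: d m_def \<rho>_def)
    have "\<exists>p t as. oumv_run (reduction A) W' n M uvs \<omega> p t as \<and> p \<le> W' \<and> real t \<le> ?T n" for \<omega>
    proof -
      from dyn[of \<omega>] obtain p ts as where 1:
        "dyn_run A (m ^ k) ?N (3 * n) (predicted n M) \<rho> \<omega> p ts as" "p \<le> m ^ k"
        "\<And>i. i < length \<rho> \<Longrightarrow> real (ts ! i) \<le> request_time (U ?N) (Q ?N) (\<rho> ! i)" by blast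
      from reduction_simulates[OF 1(1)[unfolded \<rho>_def] W(1,2)] obtain p' t ts1 ts2 where
        2: "oumv_run (reduction A) W' n M uvs \<omega> p' t (map (\<lambda>a. of_bool (0 < a)) as)"
        "ts = ts1 @ ts2" "length ts1 = n * n" "length ts = length \<rho>"
        "p' \<le> p + sum_list ts1 + 69 * (n * n) + 12 * n + 19"
        "t \<le> sum_list ts2 + length uvs * (38 * n + 10)" unfolding \<rho>_def by blast
      have "list_all2 (\<lambda>t r. real t \<le> request_time (U ?N) (Q ?N) r) (ts1 @ ts2) \<rho>"
        using 1(3) 2(2,4) by (auto simp: list_all2_conv_all_nth)
      \<comment> \<open>The request list splits at the same place as the times, after the
        \<open>n * n\<close> updates of the matrix.\<close>
      then have la: "list_all2 (\<lambda>t r. real t \<le> request_time (U ?N) (Q ?N) r) ts1 (map upd (mat_edges n M))"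
        "list_all2 (\<lambda>t r. real t \<le> request_time (U ?N) (Q ?N) r) ts2
          (concat (map (\<lambda>(u, v). round_requests n u v) uvs))"
        unfolding \<rho>_def requests_def using 2(3) by (subst (asm) list_all2_append; simp add: mat_edges_def)+
      have "real (sum_list ts1) \<le> real (n * n) * U ?N"
        using sum_list_le_sum_list_map[OF la(1)] unfolding sum_list_request_time_upd
        by (simp add: mat_edges_def)
      also have "\<dots> \<le> real ((n + 2) ^ K)" using K[OF n] .
      finally have "sum_list ts1 \<le> (n + 2) ^ K" by (simp only: of_nat_le_iff)
      then have "p' \<le> W'" using 2(5) 1(2) W(3) by linarith
      moreover have "real t \<le> ?T n"
      proof -
        have "real t \<le> real (sum_list ts2 + n * (38 * n + 10))"
          using 2(6) len by (simp only: of_nat_le_iff)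
        also have "\<dots> = real (sum_list ts2) + real n * (38 * real n + 10)" by simp
        also have "\<dots> \<le> ?T n"
          using sum_list_le_sum_list_map[OF la(2)] unfolding sum_list_request_time_rounds len by simp
        finally show ?thesis .
      qed
      ultimately show ?thesis using 2(1) by blast
    qed
    moreover have "measure fair_coins {\<omega>. \<exists>p t. oumv_run (reduction A) W' n M uvs \<omega> p t
        (map (\<lambda>(u, v). of_bool (uMv n M u v)) uvs)} \<ge> 2 / 3"
    proof -
      interpret prob_space fair_coins by (rule prob_space_fair_coins)
      note prob
      also have "measure fair_coins {\<omega>. \<exists>p ts. dyn_run A (m ^ k) ?N (3 * n) (predicted n M) \<rho> \<omega> p ts
            (correct_answers ?N (3 * n) {} \<rho>)} \<le> measure fair_coins {\<omega>. \<exists>p t. oumv_run (reduction A) W' n M uvs \<omega> p t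
        (map (\<lambda>(u, v). of_bool (uMv n M u v)) uvs)}"
      \<comment> \<open>For each coin stream on which all triangle counts are correct, their signs
        are the required OuMv answers.\<close>
      proof (rule finite_measure_mono[OF _ oumv_success_measurable], rule subsetI)
        fix \<omega> assume "\<omega> \<in> {\<omega>. \<exists>p ts. dyn_run A (m ^ k) ?N (3 * n) (predicted n M) \<rho> \<omega> p ts
            (correct_answers ?N (3 * n) {} \<rho>)}"
        then obtain p ts where "dyn_run A (m ^ k) ?N (3 * n) (predicted n M) \<rho> \<omega> p ts
            (correct_answers ?N (3 * n) {} \<rho>)" by blast
        from reduction_simulates[OF this[unfolded \<rho>_def] W(1,2)]
        show "\<omega> \<in> {\<omega>. \<exists>p t. oumv_run (reduction A) W' n M uvs \<omega> p t
          (map (\<lambda>(u, v). of_bool (uMv n M u v)) uvs)}"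
          unfolding correct_answers_requests by blast
      qed
      finally show ?thesis .
    qed
    ultimately show "(\<forall>\<omega>. \<exists>p t as. oumv_run (reduction A) ((n + 2) ^ (3 * k + K + 7)) n M uvs \<omega> p t as \<and>
               p \<le> (n + 2) ^ (3 * k + K + 7) \<and> real t \<le> ?T n) \<and>
        2 / 3 \<le> measure fair_coins
          {\<omega>. \<exists>p t. oumv_run (reduction A) ((n + 2) ^ (3 * k + K + 7)) n M uvs \<omega> p t
                   (map (\<lambda>(u, v). of_bool (uMv n M u v)) uvs)}"
      unfolding W'_def by blast
  qed
qed

theorem theorem6p14:
  assumes "OuMv_conjecture"
  shows "\<exists>d :: nat \<Rightarrow> nat. (\<lambda>n. real (d n)) \<in> O(\<lambda>n. real n) \<and>
    \<not> (\<exists>A U Q. solves_s_triangle_delayed A d U Q \<and>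
         strictly_below_power (\<lambda>n. real n ^ 2 * U n + real n * Q n) 3)"
\<comment> \<open>The simulated graph has \<open>3 * n + 1\<close> vertices and a round has
  \<open>4 * n + 1\<close> requests, so a delay of twice the number of vertices leaves enough room
  to rearrange a round.\<close>
proof (intro exI[of _ "\<lambda>n. 2 * n"] conjI notI)
  show "(\<lambda>n. real (2 * n)) \<in> O(\<lambda>n. real n)" by simp
  assume "\<exists>A U Q. solves_s_triangle_delayed A (\<lambda>n. 2 * n) U Q \<and>
         strictly_below_power (\<lambda>n. real n ^ 2 * U n + real n * Q n) 3"
  then obtain A U Q where A: "solves_s_triangle_delayed A (\<lambda>n. 2 * n) U Q"
    "strictly_below_power (\<lambda>n. real n ^ 2 * U n + real n * Q n) 3" by blast
  from reduction_time_bigo[OF A(2)] solves_s_triangle_delayed_nonneg[OF A(1)]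
    reduction_solves_oumv[OF A(1) refl A(2)] assms
  show False unfolding OuMv_conjecture_def by blast
qed

end
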